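(* Let $q$ be a prime power, $\epsilon\in[0,1)$, $t_0^s\in\mathbb{R}$, and let $n\ge k\ge2$ be integers. Let $\mathcal{C}$ be a random $(n,k)$-coding scheme over $q\mathrm{EC}(\epsilon)$. Then, almost surely (over the random choice of $\mathcal{C}$ and the random erasures), the average age of $\mathcal{C}$ is $$\Delta_{\epsilon,\mathcal{C}}=\mathbb{E}(T)-1+\frac{n(1+\epsilon_p)}{2(1-\epsilon_p)}+[-t_0^s],$$ where $\epsilon_p=\mathbb{P}(B>n)$ is the packet erasure probability, $T$ is a random variable with $\mathbb{P}(T=i)=\mathbb{P}(B=i\mid B\le n)$, and $[x]=x-\lfloor x\rfloor$.
   Context: Setting: $q\mathrm{EC}(\epsilon)$ is the memoryless erasure channel with input alphabet $\mathbb{F}_q$: each input is independently erased with probability $\epsilon$ and otherwise received unchanged and instantaneously. The $i$-th channel use ($i\ge1$) takes place at time $i$. The source message $U_m\in\mathbb{F}_q^k$ is generated at time $m+t_0^s$ (indices $m\in\mathbb{Z}$). Random $(n,k)$-scheme: for each $l\ge1$ a matrix $\mathbf{G}_l\in\mathbb{F}_q^{k\times n}$ is drawn, with all columns (over all $l$) independent and uniform on $\mathbb{F}_q^k\setminus\{0\}$, independent of the erasures, and known to encoder and decoder. The $l$-th transmitted message is $U_{m(l)}$ with $m(l)=\lfloor (l-1)n+1-t_0^s\rfloor$; the $n$ coordinates of $U_{m(l)}^T\mathbf{G}_l$ are sent in order at channel uses $(l-1)n+1,\dots,ln$. All other source messages are discarded. The $l$-th transmitted message is decoded at the first channel use in $\{(l-1)n+1,\dots,ln\}$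 (if any) at which $k$ non-erased symbols of the block with linearly independent columns of $\mathbf{G}_l$ have been received; otherwise it is lost. Age: at time $t$ the instantaneous age is $\Delta_{\epsilon,\mathcal{C}}(t)=t-(m(l)+t_0^s)$, where $l$ is the most recent transmitted message decoded at or before time $t$; before the first decoding it equals $a_0+t$ for a fixed constant $a_0$. The average age is $\Delta_{\epsilon,\mathcal{C}}=\lim_{\tau\to\infty}\frac1\tau\int_0^\tau\Delta_{\epsilon,\mathcal{C}}(t)\,dt$. The random variable $B$: let $\mathbf{g}_1,\mathbf{g}_2,\dots$ be i.i.d. uniform on $\mathbb{F}_q^k\setminus\{0\}$, each independently erased with probability $\epsilon$; $B$ is the smallest $i$ such that the non-erased vectors among $\mathbf{g}_1,\dots,\mathbf{g}_i$ span $\mathbb{F}_q^k$. Equivalently $B=\sum_{s=0}^{k-1}L_s$ with $L_s$ independent geometric variables on $\{1,2,\dots\}$ of success probability $p_s=(1-\epsilon)\frac{q^k-q^s}{q^k-1}$. *)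

theory Defs
  imports "HOL-Probability.Probability" "HOL-Library.Extended_Nat"
begin

text \<open>
  The alphabet is a finite field \<^typ>\<open>'a\<close>, so q is \<open>CARD('a)\<close>, and the message length k is
  \<open>CARD('k)\<close>. Columns of generator matrices are vectors in \<^typ>\<open>'a^'k\<close>. An erasure pattern is a
  predicate that holds where a symbol is erased. Blocks, positions inside a block and
  channel uses are all counted from 1.
\<close>

text \<open>
  The product law together with the independence over \<open>I\<close> says that all columns and all
  erasure flags are jointly independent, the columns being uniform on the nonzero vectors
  and every flag being true with probability \<open>eps\<close>.
\<close>

definition iid_columns_with_erasures ::
  "'w measure \<Rightarrow> real \<Rightarrow> 'i set \<Rightarrow> ('i \<Rightarrow> 'w \<Rightarrow> ('a::{field,finite})^('k::finite))
    \<Rightarrow> ('i \<Rightarrow> 'w \<Rightarrow> bool) \<Rightarrow> bool"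
where
  "iid_columns_with_erasures M eps I g x \<longleftrightarrow>
     prob_space M \<and>
     prob_space.indep_vars M (\<lambda>_. count_space UNIV) (\<lambda>i \<omega>. (g i \<omega>, x i \<omega>)) I \<and>
     (\<forall>i\<in>I. distr M (count_space UNIV) (\<lambda>\<omega>. (g i \<omega>, x i \<omega>)) =
        measure_pmf (pair_pmf (pmf_of_set (UNIV - {0})) (bernoulli_pmf eps)))"

definition channel_use :: "nat \<Rightarrow> nat \<Rightarrow> nat \<Rightarrow> nat" where
  "channel_use n l j = (l - 1) * n + j"

text \<open>
  \<open>G l j\<close> is the \<open>j\<close>-th column of the \<open>l\<close>-th generator matrix, which is used at channel
  use \<open>channel_use n l j\<close>; \<open>X i\<close> is the erasure flag of channel use \<open>i\<close>.
\<close>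

definition random_scheme ::
  "'w measure \<Rightarrow> real \<Rightarrow> nat \<Rightarrow> (nat \<Rightarrow> nat \<Rightarrow> 'w \<Rightarrow> ('a::{field,finite})^('k::finite))
    \<Rightarrow> (nat \<Rightarrow> 'w \<Rightarrow> bool) \<Rightarrow> bool"
where
  "random_scheme M eps n G X \<longleftrightarrow>
     iid_columns_with_erasures M eps ({1..} \<times> {1..n})
       (\<lambda>(l, j). G l j) (\<lambda>(l, j). X (channel_use n l j))"

definition message_index :: "nat \<Rightarrow> real \<Rightarrow> nat \<Rightarrow> int" where
  "message_index n t0 l = \<lfloor>(real l - 1) * real n + 1 - t0\<rfloor>"

text \<open>
  The remaining definitions up to the average age concern one realization: \<open>G\<close> and \<open>X\<close> are
  fixed columns and erasure flags. Decoding depends only on these, not on the values of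
  the source messages.
\<close>

definition decodable_at ::
  "nat \<Rightarrow> (nat \<Rightarrow> nat \<Rightarrow> ('a::field)^('k::finite)) \<Rightarrow> (nat \<Rightarrow> bool) \<Rightarrow> nat \<Rightarrow> nat \<Rightarrow> bool"
where
  "decodable_at n G X l i \<longleftrightarrow>
     (\<exists>J \<subseteq> {1..i}. card J = CARD('k) \<and> (\<forall>j\<in>J. \<not> X (channel_use n l j)) \<and>
        inj_on (G l) J \<and> vec.independent (G l ` J))"

definition is_decoded ::
  "nat \<Rightarrow> (nat \<Rightarrow> nat \<Rightarrow> ('a::field)^('k::finite)) \<Rightarrow> (nat \<Rightarrow> bool) \<Rightarrow> nat \<Rightarrow> bool"
where
  "is_decoded n G X l \<longleftrightarrow> (\<exists>i\<in>{1..n}. decodable_at n G X l i)"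

text \<open>Only meaningful if \<open>is_decoded n G X l\<close> holds.\<close>

definition decoding_time ::
  "nat \<Rightarrow> (nat \<Rightarrow> nat \<Rightarrow> ('a::field)^('k::finite)) \<Rightarrow> (nat \<Rightarrow> bool) \<Rightarrow> nat \<Rightarrow> nat"
where
  "decoding_time n G X l =
     channel_use n l (LEAST i. i \<in> {1..n} \<and> decodable_at n G X l i)"

definition decoded_by ::
  "nat \<Rightarrow> (nat \<Rightarrow> nat \<Rightarrow> ('a::field)^('k::finite)) \<Rightarrow> (nat \<Rightarrow> bool) \<Rightarrow> real \<Rightarrow> nat set"
where
  "decoded_by n G X t =
     {l. 1 \<le> l \<and> is_decoded n G X l \<and> real (decoding_time n G X l) \<le> t}"

text \<open>
  The set \<open>decoded_by n G X t\<close> is finite for \<open>n \<ge> 1\<close>, so its maximum is the most recent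
  decoded message. A message index counts from an offset \<open>t0\<close>, i.e. message \<open>m\<close> is
  generated at time \<open>m + t0\<close>.
\<close>

definition age ::
  "nat \<Rightarrow> real \<Rightarrow> real \<Rightarrow> (nat \<Rightarrow> nat \<Rightarrow> ('a::field)^('k::finite)) \<Rightarrow> (nat \<Rightarrow> bool)
    \<Rightarrow> real \<Rightarrow> real"
where
  "age n t0 a0 G X t =
     (if decoded_by n G X t = {} then a0 + t
      else t - (real_of_int (message_index n t0 (Max (decoded_by n G X t))) + t0))"

text \<open>Integrability is required so that the integrals in the limit are not default values.\<close>

definition has_average :: "(real \<Rightarrow> real) \<Rightarrow> real \<Rightarrow> bool" where
  "has_average f A \<longleftrightarrow>
     (\<forall>\<tau>\<ge>0. f integrable_on {0..\<tau>}) \<and>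
     ((\<lambda>\<tau>. 1 / \<tau> * integral {0..\<tau>} f) \<longlongrightarrow> A) at_top"

text \<open>
  The value is \<open>\<infinity>\<close> on the null event that the received vectors never span the whole space.
\<close>

definition spanning_time :: "(nat \<Rightarrow> ('a::field)^('k::finite)) \<Rightarrow> (nat \<Rightarrow> bool) \<Rightarrow> enat" where
  "spanning_time g x =
     (INF i\<in>{i. vec.span {g j |j. j \<in> {1..i} \<and> \<not> x j} = UNIV}. enat i)"

end

theory Submission
  imports Defs "HOL-Real_Asymp.Real_Asymp"
begin

text \<open>
  Call the delay of a block the number of its channel uses until decoding, and the gap of
  block \<open>l\<close> the number of blocks since the last decoded block before \<open>l\<close>. Up to an additive
  constant, the age integrated over block \<open>l\<close> is \<open>n\<^sup>2/2 + n \<cdot> gap \<cdot> min(delay, n)\<close>. The gaps of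
  the decoded blocks telescope to the number of blocks, so after subtracting a multiple of the
  decoding indicator from \<open>min(delay, n)\<close> one is left with \<open>\<Sum> gap l \<cdot> Y l\<close> for i.i.d. centred
  \<open>Y l\<close> that are independent of \<open>gap l\<close>. This sum has orthogonal increments and the gaps have
  bounded second moments, so it is almost surely negligible along the square numbers of blocks;
  the time integral of the nonnegative age is monotone, which extends the limit to all times.
\<close>

section \<open>Decoding delay of a block\<close>

text \<open>Cutting time at block boundaries instead of at decodings makes the number of summands up
  to a given time deterministic; the price is that the summands are dependent through their gaps.
  The second moment of the centred average over L blocks is bounded only by a multiple of 1/L, which
  is summable along L = m^2 but not along all L; this is where the squares come from.

  The limit has three sources. Let p = 1 - eps_p be the probability that a block is decoded. The
  weighted sum divided by the number of blocks tends to E(min(delay, n)) / p. A decoded block has a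
  delay distributed like T and a lost block counts n, so this is E(T) + n (1 - p) / p. The slope of
  the age adds n/2, and n/2 + n (1 - p) / p = n (1 + eps_p) / (2 (1 - eps_p)). Finally -1 +
  frac(-t0) appears because the message of block l is generated at (l - 1) n + 1 - frac(-t0) and not
  at the block boundary (l - 1) n.\<close>

definition spans_by :: "nat \<Rightarrow> (nat \<Rightarrow> (('a::field)^('k::finite)) \<times> bool) \<Rightarrow> bool" where
  "spans_by i v \<longleftrightarrow> vec.span {fst (v j) |j. j \<in> {1..i} \<and> \<not> snd (v j)} = UNIV"

text \<open>The value \<open>Suc n\<close> stands for a lost block.\<close>

definition delay :: "nat \<Rightarrow> (nat \<Rightarrow> (('a::field)^('k::finite)) \<times> bool) \<Rightarrow> nat" where
  "delay n v = (LEAST i. i = Suc n \<or> spans_by i v)"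

lemma spans_by_cong:
  assumes "\<And>j. j \<in> {1..i} \<Longrightarrow> v j = w j"
  shows "spans_by i v = spans_by i w"
proof -
  have "{fst (v j) |j. j \<in> {1..i} \<and> \<not> snd (v j)} = {fst (w j) |j. j \<in> {1..i} \<and> \<not> snd (w j)}"
    using assms by force
  then show ?thesis by (simp add: spans_by_def)
qed

lemma spans_by_mono:
  assumes "spans_by i v" "i \<le> i'"
  shows "spans_by i' v"
proof -
  have "vec.span {fst (v j) |j. j \<in> {1..i} \<and> \<not> snd (v j)}
      \<subseteq> vec.span {fst (v j) |j. j \<in> {1..i'} \<and> \<not> snd (v j)}"
    using assms(2) by (intro vec.span_mono) force
  with assms(1) show ?thesis by (auto simp: spans_by_def)
qed

lemma not_spans_by_0: "\<not> spans_by 0 (v :: nat \<Rightarrow> (('a::field)^('k::finite)) \<times> bool)"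
proof
  assume "spans_by 0 v"
  then have "(UNIV :: ('a^'k) set) = {0}" by (simp add: spans_by_def)
  then have "axis undefined 1 = (0 :: 'a^'k)" by blast
  then show False by (simp add: axis_eq_0_iff)
qed

lemma delay_le: "delay n v \<le> Suc n"
  unfolding delay_def by (rule Least_le) simp

lemma delay_le_iff: "i \<le> n \<Longrightarrow> delay n v \<le> i \<longleftrightarrow> spans_by i v"
proof
  assume i: "i \<le> n" "delay n v \<le> i"
  have "delay n v = Suc n \<or> spans_by (delay n v) v"
    unfolding delay_def by (rule LeastI[of _ "Suc n"]) simp
  with i show "spans_by i v" by (auto intro: spans_by_mono)
next
  assume "spans_by i v"
  then show "delay n v \<le> i" unfolding delay_def by (intro Least_le) simp
qed

lemma delay_ge_1: "1 \<le> delay n v"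
  using delay_le_iff[of 0 n v] not_spans_by_0[of v] by (cases "delay n v") auto

text \<open>Allows a block to be replaced by its restriction to \<open>{1..n}\<close>, a point of a
  finite product space, wherever measurability, independence or laws are at stake.\<close>

lemma delay_cong:
  assumes "\<And>j. j \<in> {1..n} \<Longrightarrow> v j = w j"
  shows "delay n v = delay n w"
proof -
  have "delay n v \<le> i \<longleftrightarrow> delay n w \<le> i" for i
  proof (cases "i \<le> n")
    case True
    with assms show ?thesis by (auto simp: delay_le_iff intro!: spans_by_cong)
  next
    case False
    then show ?thesis using delay_le[of n v] delay_le[of n w] by linarith
  qed
  then show ?thesis by (metis le_antisym order_refl)
qed

lemma delay_eqI:
  assumes "1 \<le> i" "i \<le> n"
  shows "delay n v = i \<longleftrightarrow> spans_by i v \<and> \<not> spans_by (i - 1) v"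
proof -
  have "delay n v = i \<longleftrightarrow> delay n v \<le> i \<and> \<not> delay n v \<le> i - 1"
    using assms(1) by linarith
  then show ?thesis using assms(2) by (simp add: delay_le_iff)
qed

text \<open>By dimension, k independent received columns span the space, and a spanning set contains
  a basis of k columns. Pairing each column with its flag gives a block of the scheme and the
  process behind \<open>B\<close> the same form.\<close>

lemma decodable_at_iff_spans_by:
  "decodable_at n G X l i \<longleftrightarrow> spans_by i (\<lambda>j. (G l j, X (channel_use n l j)))"
  for G :: "nat \<Rightarrow> nat \<Rightarrow> ('a::field)^('k::finite)"
proof -
  let ?R = "{j \<in> {1..i}. \<not> X (channel_use n l j)}"
  have R: "{fst (G l j, X (channel_use n l j)) |j. j \<in> {1..i} \<and> \<not> snd (G l j, X (channel_use n l j))}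
      = G l ` ?R" by auto
  show ?thesis
  proof
    assume "decodable_at n G X l i"
    then obtain J where J: "J \<subseteq> {1..i}" "card J = CARD('k)" "\<forall>j\<in>J. \<not> X (channel_use n l j)"
      "inj_on (G l) J" "vec.independent (G l ` J)"
      by (auto simp: decodable_at_def)
    have "card (G l ` J) = vec.dim (UNIV :: ('a^'k) set)"
      unfolding vec_dim_card card_image[OF J(4)] by (rule J(2))
    then have "UNIV \<subseteq> vec.span (G l ` J)"
      using J(5) by (intro vec.card_ge_dim_independent) auto
    moreover have "vec.span (G l ` J) \<subseteq> vec.span (G l ` ?R)"
      using J(1,3) by (intro vec.span_mono) auto
    ultimately show "spans_by i (\<lambda>j. (G l j, X (channel_use n l j)))"
      unfolding spans_by_def R by auto
  next
    assume "spans_by i (\<lambda>j. (G l j, X (channel_use n l j)))"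
    then have U: "vec.span (G l ` ?R) = UNIV" unfolding spans_by_def R .
    obtain S where S: "S \<subseteq> G l ` ?R" "vec.independent S" "G l ` ?R \<subseteq> vec.span S"
      using vec.maximal_independent_subset by blast
    then have "vec.span S = UNIV"
      using U vec.span_minimal[OF S(3) vec.subspace_span] by auto
    then have "card S = CARD('k)"
      using vec.dim_span_eq_card_independent[OF S(2)] by (simp only: vec_dim_card)
    \<comment> \<open>The same column may be received at several positions; one position is chosen
      for each vector of \<open>S\<close>, which gives the injectivity that
      \<open>decodable_at\<close> asks for.\<close>
    moreover obtain J where J: "J \<subseteq> ?R" "inj_on (G l) J" "S = G l ` J"
      using S(1) by (auto simp: subset_image_inj)
    ultimately show "decodable_at n G X l i"
      using S(2) unfolding decodable_at_def
      by (intro exI[of _ J]) (auto simp: card_image)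
  qed
qed

lemma is_decoded_iff_delay:
  "is_decoded n G X l \<longleftrightarrow> delay n (\<lambda>j. (G l j, X (channel_use n l j))) \<le> n"
proof -
  let ?v = "\<lambda>j. (G l j, X (channel_use n l j))"
  have "is_decoded n G X l \<longleftrightarrow> (\<exists>i\<in>{1..n}. spans_by i ?v)"
    by (simp add: is_decoded_def decodable_at_iff_spans_by)
  also have "\<dots> \<longleftrightarrow> spans_by n ?v"
  proof
    assume "spans_by n ?v"
    moreover from this have "n \<noteq> 0" using not_spans_by_0[of ?v] by (intro notI) simp
    ultimately show "\<exists>i\<in>{1..n}. spans_by i ?v" by (intro bexI[of _ n]) simp_all
  qed (auto intro: spans_by_mono)
  finally show ?thesis by (simp add: delay_le_iff)
qed

lemma decoding_time_eq_delay:
  assumes "is_decoded n G X l"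
  shows "decoding_time n G X l
    = channel_use n l (delay n (\<lambda>j. (G l j, X (channel_use n l j))))"
proof -
  let ?v = "\<lambda>j. (G l j, X (channel_use n l j))"
  have le: "delay n ?v \<le> n" using assms is_decoded_iff_delay by blast
  have "(LEAST i. i \<in> {1..n} \<and> decodable_at n G X l i) = delay n ?v"
  proof (rule Least_equality)
    show "delay n ?v \<in> {1..n} \<and> decodable_at n G X l (delay n ?v)"
      using le delay_ge_1[of n ?v] delay_le_iff[OF le, of ?v]
      by (simp add: decodable_at_iff_spans_by)
    show "delay n ?v \<le> i" if "i \<in> {1..n} \<and> decodable_at n G X l i" for i
      using that by (simp add: decodable_at_iff_spans_by delay_le_iff)
  qed
  then show ?thesis by (simp add: decoding_time_def)
qed

text \<open>The indices in the infimum form an upward closed set, so failure at \<open>i\<close>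
  bounds all of them below by \<open>Suc i\<close>. This includes the empty set, whose infimum is
  \<infinity>.\<close>

lemma spanning_time_le_iff:
  "spanning_time g x \<le> enat i \<longleftrightarrow> spans_by i (\<lambda>j. (g j, x j))"
proof -
  let ?v = "\<lambda>j. (g j, x j)"
  have eq: "spanning_time g x = (INF i\<in>{i. spans_by i ?v}. enat i)"
    by (simp add: spanning_time_def spans_by_def)
  show ?thesis
  proof
    assume le: "spanning_time g x \<le> enat i"
    show "spans_by i ?v"
    proof (rule ccontr)
      assume "\<not> spans_by i ?v"
      then have "enat (Suc i) \<le> spanning_time g x"
        unfolding eq by (intro INF_greatest) (auto intro: spans_by_mono simp: not_less_eq_eq[symmetric])
      from order_trans[OF this le] show False by simp
    qed
  next
    assume "spans_by i ?v"
    then show "spanning_time g x \<le> enat i" unfolding eq by (intro INF_lower) simp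
  qed
qed

lemma spanning_time_eq_iff:
  assumes "1 \<le> i" "i \<le> n"
  shows "spanning_time g x = enat i \<longleftrightarrow> delay n (\<lambda>j. (g j, x j)) = i"
proof -
  have "spanning_time g x = enat i \<longleftrightarrow>
      spanning_time g x \<le> enat i \<and> \<not> spanning_time g x \<le> enat (i - 1)"
    using assms(1) by (cases "spanning_time g x") auto
  then show ?thesis by (simp add: delay_eqI[OF assms] spanning_time_le_iff)
qed

section \<open>The age of a fixed sequence of delays\<close>

text \<open>
  Here \<open>Z\<close> tells which blocks are decoded. Block 0 counts as decoded, whatever \<open>Z 0\<close> is.
\<close>

primrec gap :: "(nat \<Rightarrow> bool) \<Rightarrow> nat \<Rightarrow> nat" where
  "gap Z 0 = 0"
| "gap Z (Suc l) = (if Z l then 1 else Suc (gap Z l))"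

lemma gap_le: "gap Z l \<le> l"
  by (induction l) auto

text \<open>The reason why the gap of a block is independent of its own delay. \<open>Z 0\<close>
  may differ from \<open>Z' 0\<close> because both branches of the recursion give 1 at
  \<open>Suc 0\<close>.\<close>

lemma gap_Suc_cong:
  assumes "\<And>j. j \<in> {1..l} \<Longrightarrow> Z j = Z' j"
  shows "gap Z (Suc l) = gap Z' (Suc l)"
  using assms
proof (induction l)
  case (Suc l)
  then have "gap Z (Suc l) = gap Z' (Suc l)" "Z (Suc l) = Z' (Suc l)" by auto
  then show ?case by (simp only: gap.simps(2)[of _ "Suc l"])
qed simp

lemma gap_spec:
  "l - gap Z l = 0 \<or> (l - gap Z l < l \<and> Z (l - gap Z l))"
  "l - gap Z l < j \<Longrightarrow> j < l \<Longrightarrow> \<not> Z j"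
proof (induction l)
  case (Suc l)
  { case 1 then show ?case using Suc.IH(1) by auto }
  { case 2 then show ?case using Suc.IH(2) by (cases "j = l") (auto split: if_splits) }
qed auto

text \<open>A hit at \<open>Suc L\<close> moves the current gap into the sum and restarts it at 1, a
  miss lengthens it by 1; either way the total grows by 1. The final gap is an error term, to be
  shown negligible against \<open>L\<close>.\<close>

lemma sum_gap_hits: "(\<Sum>l=1..L. gap Z l * of_bool (Z l)) + gap Z (Suc L) = Suc L"
proof (induction L)
  case (Suc L)
  have "(\<Sum>l=1..Suc L. gap Z l * of_bool (Z l)) + gap Z (Suc (Suc L))
      = (\<Sum>l=1..L. gap Z l * of_bool (Z l)) + Suc (gap Z (Suc L))"
    by (simp add: gap.simps(2)[of _ "Suc L"] del: gap.simps)
  with Suc.IH show ?case by simp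
qed simp

text \<open>Between two consecutive squares \<open>F\<close> is squeezed by its values there, and
  replacing \<open>t\<close> by either end changes the quotient by at most the factor ((m + 1) /
  m)^2, which tends to 1. In the application \<open>c\<close> is the block length.\<close>

lemma tendsto_of_tendsto_along_squares:
  fixes F :: "real \<Rightarrow> real"
  assumes mono: "\<And>s t. 0 \<le> s \<Longrightarrow> s \<le> t \<Longrightarrow> F s \<le> F t" and nonneg: "\<And>t. 0 \<le> t \<Longrightarrow> 0 \<le> F t"
    and c: "0 < c" and lim: "(\<lambda>m. F (real (m\<^sup>2) * c) / (real (m\<^sup>2) * c)) \<longlonglongrightarrow> A"
  shows "((\<lambda>t. F t / t) \<longlongrightarrow> A) at_top"
proof -
  define a where "a = (\<lambda>m. F (real (m\<^sup>2) * c) / (real (m\<^sup>2) * c))"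
  define m where "m = (\<lambda>t. nat \<lfloor>sqrt (t / c)\<rfloor>)"
  have "filterlim (\<lambda>t. t / c) at_top at_top"
    using c by real_asymp
  then have m: "filterlim m sequentially at_top"
    unfolding m_def
    by (intro filterlim_compose[OF filterlim_nat_sequentially]
        filterlim_compose[OF filterlim_floor_sequentially] filterlim_compose[OF sqrt_at_top])
  have lower: "(\<lambda>m. a m * (real m / (real m + 1))\<^sup>2) \<longlonglongrightarrow> A * 1"
    by (intro tendsto_mult lim[folded a_def]) real_asymp
  have upper: "(\<lambda>m. a (Suc m) * ((real m + 1) / real m)\<^sup>2) \<longlonglongrightarrow> A * 1"
    by (intro tendsto_mult LIMSEQ_Suc[OF lim[folded a_def]]) real_asymp
  have ev: "eventually (\<lambda>t. 0 < t \<and> 1 \<le> m t) at_top"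
    using eventually_gt_at_top[of 0] m by (auto simp: filterlim_at_top intro: eventually_conj)
  have bounds: "real ((m t)\<^sup>2) * c \<le> t" "t \<le> real ((Suc (m t))\<^sup>2) * c" if "0 < t" for t
  proof -
    have m: "real (m t) \<le> sqrt (t / c)" "sqrt (t / c) \<le> real (Suc (m t))"
      using that c by (auto simp: m_def) linarith+
    have s: "(sqrt (t / c))\<^sup>2 = t / c" using that c by simp
    have "real (m t)^2 \<le> t / c" "t / c \<le> real (Suc (m t))^2"
      using power_mono[OF m(1), of 2] power_mono[OF m(2), of 2] that c by (simp_all add: s)
    then show "real ((m t)\<^sup>2) * c \<le> t" "t \<le> real ((Suc (m t))\<^sup>2) * c"
      using c by (simp_all add: field_simps)
  qed
  show ?thesis
  proof (rule tendsto_sandwich)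
    show "eventually (\<lambda>t. a (m t) * (real (m t) / (real (m t) + 1))\<^sup>2 \<le> F t / t) at_top"
      using ev
    proof eventually_elim
      case (elim t)
      have "a (m t) * (real (m t) / (real (m t) + 1))\<^sup>2
          = F (real ((m t)\<^sup>2) * c) / (real ((Suc (m t))\<^sup>2) * c)"
        using elim c by (simp add: a_def power_divide add.commute)
      also have "\<dots> \<le> F t / t"
        using elim c bounds[of t] by (intro frac_le mono nonneg) auto
      finally show ?case .
    qed
    show "eventually (\<lambda>t. F t / t \<le> a (Suc (m t)) * ((real (m t) + 1) / real (m t))\<^sup>2) at_top"
      using ev
    proof eventually_elim
      case (elim t)
      have "F t / t \<le> F (real ((Suc (m t))\<^sup>2) * c) / (real ((m t)\<^sup>2) * c)"
        using elim c bounds[of t] by (intro frac_le mono nonneg) auto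
      also have "\<dots> = a (Suc (m t)) * ((real (m t) + 1) / real (m t))\<^sup>2"
      proof -
        have "real ((Suc (m t))\<^sup>2) = (real (m t) + 1)\<^sup>2" by (simp add: add.commute)
        then have "a (Suc (m t)) = F (real ((Suc (m t))\<^sup>2) * c) / ((real (m t) + 1)\<^sup>2 * c)"
          by (simp only: a_def)
        then show ?thesis using elim c by (simp add: power_divide)
      qed
      finally show ?case .
    qed
    show "((\<lambda>t. a (m t) * (real (m t) / (real (m t) + 1))\<^sup>2) \<longlongrightarrow> A) at_top"
      using filterlim_compose[OF lower m] by simp
    show "((\<lambda>t. a (Suc (m t)) * ((real (m t) + 1) / real (m t))\<^sup>2) \<longlongrightarrow> A) at_top"
      using filterlim_compose[OF upper m] by simp
  qed
qed

text \<open>One realization, reduced to its delays; any value above \<open>n\<close> stands for a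
  lost block.\<close>

locale block_delays =
  fixes n :: nat and D :: "nat \<Rightarrow> nat"
  assumes n_pos: "1 \<le> n" and D_ge_1: "\<And>l. 1 \<le> D l"
begin

abbreviation "gp \<equiv> gap (\<lambda>l. D l \<le> n)"

definition decoded :: "real \<Rightarrow> nat set" where
  "decoded t = {l. 1 \<le> l \<and> D l \<le> n \<and> real (channel_use n l (D l)) \<le> t}"

text \<open>Up to a constant, this is the age if block 0 is counted as decoded.\<close>

definition ideal_age :: "real \<Rightarrow> real" where
  "ideal_age t = t + real n - real n * real (Max (insert 0 (decoded t)))"

lemma channel_use_mono:
  assumes "1 \<le> j" "j < l" "D j \<le> n"
  shows "channel_use n j (D j) \<le> (l - 1) * n"
proof -
  have "channel_use n j (D j) \<le> (j - 1) * n + n" using assms by (simp add: channel_use_def)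
  also have "\<dots> = j * n" using assms(1) by (cases j) auto
  also have "\<dots> \<le> (l - 1) * n" using assms by (intro mult_right_mono) auto
  finally show ?thesis .
qed

text \<open>The window reaches up to \<open>Suc b * n + 1\<close> because delays are at least 1, so
  no later block is decoded before that time. Hence the closed time interval of a block, right end
  included, obeys a single description.\<close>

lemma decoded_block:
  assumes "real (b * n) \<le> t" "t < real (Suc b * n) + 1"
  shows "decoded t = {j. 1 \<le> j \<and> D j \<le> n \<and>
    (j < Suc b \<or> (j = Suc b \<and> real (b * n + D j) \<le> t))}"
proof -
  have "real (channel_use n j (D j)) \<le> t \<longleftrightarrow> j < Suc b \<or> (j = Suc b \<and> real (b * n + D j) \<le> t)"
    if j: "1 \<le> j" "D j \<le> n" for j
  proof -
    consider "j < Suc b" | "j = Suc b" | "Suc b < j" by linarith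
    then show ?thesis
    proof cases
      case 1
      then have "channel_use n j (D j) \<le> b * n"
        using channel_use_mono[of j "Suc b"] j by simp
      then have "real (channel_use n j (D j)) \<le> real (b * n)" by (simp only: of_nat_le_iff)
      with assms(1) 1 show ?thesis by linarith
    next
      case 2
      then show ?thesis by (simp add: channel_use_def)
    next
      case 3
      have "Suc b * n \<le> (j - 1) * n" using 3 by (intro mult_right_mono) auto
      then have "Suc b * n + 1 \<le> channel_use n j (D j)"
        using D_ge_1[of j] by (simp add: channel_use_def)
      then have "real (Suc b * n) + 1 \<le> real (channel_use n j (D j))"
        by (metis of_nat_1 of_nat_add of_nat_le_iff)
      with assms(2) 3 show ?thesis by linarith
    qed
  qed
  then show ?thesis unfolding decoded_def by blast
qed

lemma ideal_age_block:
  assumes "real (b * n) \<le> t" "t < real (Suc b * n) + 1"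
  shows "ideal_age t = (if D (Suc b) \<le> n \<and> real (b * n + D (Suc b)) \<le> t
     then t - real (b * n) else t - real (b * n) + real n * real (gp (Suc b)))"
proof -
  let ?g = "gp (Suc b)"
  note dec = decoded_block[OF assms]
  have fin: "finite (insert 0 (decoded t))"
    unfolding dec by (rule finite_subset[of _ "{..Suc b}"]) auto
  show ?thesis
  proof (cases "D (Suc b) \<le> n \<and> real (b * n + D (Suc b)) \<le> t")
    case True
    have "Max (insert 0 (decoded t)) = Suc b"
      using fin True by (intro Max_eqI) (auto simp: dec)
    with True show ?thesis by (simp add: ideal_age_def algebra_simps)
  next
    case False
    have "Max (insert 0 (decoded t)) = Suc b - ?g"
    proof (rule Max_eqI[OF fin])
      fix j assume "j \<in> insert 0 (decoded t)"
      then have "j = 0 \<or> (j < Suc b \<and> D j \<le> n)" using False by (auto simp: dec)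
      then show "j \<le> Suc b - ?g" using gap_spec(2)[of "Suc b" "\<lambda>l. D l \<le> n" j] by force
    next
      have "Suc b - ?g = 0 \<or> (1 \<le> Suc b - ?g \<and> Suc b - ?g < Suc b \<and> D (Suc b - ?g) \<le> n)"
        using gap_spec(1)[of "Suc b" "\<lambda>l. D l \<le> n"] by linarith
      then show "Suc b - ?g \<in> insert 0 (decoded t)" unfolding dec by blast
    qed
    moreover have "real (Suc b - ?g) = real (Suc b) - real ?g"
      using gap_le by (intro of_nat_diff)
    ultimately show ?thesis using False
      by (auto simp: ideal_age_def algebra_simps simp del: gap.simps)
  qed
qed

text \<open>On the block the age is a ramp that starts at 0 and contributes n^2/2, plus a surcharge
  of n times the gap. The surcharge lasts until the block is decoded, or to its end if the block is
  lost.\<close>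

lemma ideal_age_block_integral:
  "(ideal_age has_integral
     (real n)\<^sup>2 / 2 + real n * (real (gp (Suc b)) * real (min (D (Suc b)) n)))
   {real (b * n)..real (Suc b * n)}"
proof -
  let ?g = "real (gp (Suc b))"
  define e where "e = min (D (Suc b)) n"
  define c where "c = real (b * n) + real e"
  have e: "e \<le> n" by (simp add: e_def)
  have c: "real (b * n) \<le> c" "c \<le> real (Suc b * n)" using e by (auto simp: c_def)
  have "((\<lambda>t. t - real (b * n) + real n * ?g) has_integral
      ((c - real (b * n))\<^sup>2 / 2 + real n * ?g * c) -
      ((real (b * n) - real (b * n))\<^sup>2 / 2 + real n * ?g * real (b * n))) {real (b * n)..c}"
    using c(1) by (intro fundamental_theorem_of_calculus)
      (auto intro!: derivative_eq_intros simp: has_real_derivative_iff_has_vector_derivative[symmetric])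
  then have I1: "(ideal_age has_integral
      ((c - real (b * n))\<^sup>2 / 2 + real n * ?g * c) -
      ((real (b * n) - real (b * n))\<^sup>2 / 2 + real n * ?g * real (b * n))) {real (b * n)..c}"
  \<comment> \<open>If the block is decoded, the surcharge is already gone at \<open>c\<close>
    itself; one point does not affect the integral.\<close>
  proof (rule has_integral_spike_finite[rotated 2])
    show "ideal_age t = t - real (b * n) + real n * ?g" if "t \<in> {real (b * n)..c} - {c}" for t
    proof -
      have t: "real (b * n) \<le> t" "t < c" using that by auto
      have "\<not> (D (Suc b) \<le> n \<and> real (b * n + D (Suc b)) \<le> t)"
        using t by (auto simp: c_def e_def)
      moreover have "t < real (Suc b * n) + 1" using t c by linarith
      ultimately show ?thesis by (simp only: ideal_age_block[OF t(1)] if_False)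
    qed
  qed simp
  have I2: "(ideal_age has_integral
      ((real (Suc b * n) - real (b * n))\<^sup>2 / 2 - (c - real (b * n))\<^sup>2 / 2)) {c..real (Suc b * n)}"
  proof (cases "D (Suc b) \<le> n")
    case True
    have "((\<lambda>t. t - real (b * n)) has_integral
      ((real (Suc b * n) - real (b * n))\<^sup>2 / 2 - (c - real (b * n))\<^sup>2 / 2)) {c..real (Suc b * n)}"
      using c(2) by (intro fundamental_theorem_of_calculus)
        (auto intro!: derivative_eq_intros simp: has_real_derivative_iff_has_vector_derivative[symmetric])
    then show ?thesis
    proof (rule has_integral_eq[rotated])
      fix t assume t: "t \<in> {c..real (Suc b * n)}"
      have "real (b * n + D (Suc b)) \<le> t" "real (b * n) \<le> t" "t < real (Suc b * n) + 1"
        using t True c(1) by (auto simp: c_def e_def)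
      then show "t - real (b * n) = ideal_age t" using ideal_age_block[of b t] True by simp
    qed
  next
    case False
    then have "c = real (Suc b * n)" by (simp add: c_def e_def)
    then show ?thesis by (simp add: has_integral_refl)
  qed
  have "real (Suc b * n) - real (b * n) = real n" by simp
  then have eq: "((c - real (b * n))\<^sup>2 / 2 + real n * ?g * c) -
      ((real (b * n) - real (b * n))\<^sup>2 / 2 + real n * ?g * real (b * n)) +
      ((real (Suc b * n) - real (b * n))\<^sup>2 / 2 - (c - real (b * n))\<^sup>2 / 2)
      = (real n)\<^sup>2 / 2 + real n * (?g * real e)"
    by (simp add: c_def algebra_simps del: gap.simps of_nat_mult of_nat_Suc)
  from has_integral_combine[OF c I1 I2] show ?thesis unfolding eq by (simp only: e_def)
qed

lemma ideal_age_integral: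
  "(ideal_age has_integral
     real L * (real n)\<^sup>2 / 2 + real n * (\<Sum>l=1..L. real (gp l) * real (min (D l) n)))
   {0..real (L * n)}"
proof (induction L)
  case 0
  then show ?case by (simp add: has_integral_refl)
next
  case (Suc L)
  have "(ideal_age has_integral
      (real L * (real n)\<^sup>2 / 2 + real n * (\<Sum>l=1..L. real (gp l) * real (min (D l) n))) +
      ((real n)\<^sup>2 / 2 + real n * (real (gp (Suc L)) * real (min (D (Suc L)) n))))
      {0..real (Suc L * n)}"
    by (rule has_integral_combine[OF _ _ Suc.IH ideal_age_block_integral]) auto
  then show ?case by (simp add: algebra_simps add_divide_distrib del: gap.simps)
qed

section \<open>From block integrals to the time average\<close>

lemma ideal_age_integrable: "ideal_age integrable_on {0..t}"
proof -
  obtain L :: nat where "t / real n \<le> real L" using real_arch_simple by blast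
  then have "t \<le> real (L * n)" using n_pos by (simp add: field_simps)
  then show ?thesis
    using integrable_on_subinterval[OF has_integral_integrable[OF ideal_age_integral[of L]], of 0 t]
    by auto
qed

lemma finite_decoded: "finite (decoded t)"
proof (rule finite_subset)
  show "decoded t \<subseteq> {..nat \<lfloor>t\<rfloor>}"
  proof
    fix l assume "l \<in> decoded t"
    then have l: "1 \<le> l" "real (channel_use n l (D l)) \<le> t" by (auto simp: decoded_def)
    have "l - 1 \<le> (l - 1) * n" using n_pos by simp
    then have "l \<le> channel_use n l (D l)"
      using D_ge_1[of l] unfolding channel_use_def by linarith
    then have "real l \<le> t" using l(2) by linarith
    then show "l \<in> {..nat \<lfloor>t\<rfloor>}" by (simp add: le_nat_floor)
  qed
qed simp

text \<open>A block can be decoded only after it has begun, so \<open>(l - 1) * n\<close> is at most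
  \<open>t\<close> for the last decoded block \<open>l\<close>. Nonnegativity makes the integral
  monotone in \<open>t\<close>; the actual age can be negative before the first decoding, since
  \<open>a0\<close> is arbitrary.\<close>

lemma ideal_age_nonneg:
  assumes "0 \<le> t"
  shows "0 \<le> ideal_age t"
proof -
  let ?l = "Max (insert 0 (decoded t))"
  have "?l \<in> insert 0 (decoded t)" using finite_decoded by (intro Max_in) auto
  then consider "?l = 0" | "1 \<le> ?l" "real (channel_use n ?l (D ?l)) \<le> t"
    by (auto simp: decoded_def)
  then have "real n * real ?l \<le> t + real n"
  proof cases
    case 1
    then show ?thesis using assms by simp
  next
    case 2
    have "real ((?l - 1) * n) \<le> real (channel_use n ?l (D ?l))"
      unfolding of_nat_le_iff by (simp add: channel_use_def)
    with 2(2) have "real ((?l - 1) * n) \<le> t" by linarith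
    moreover have "real ((?l - 1) * n) = real n * real ?l - real n"
      using 2(1) by (simp add: algebra_simps of_nat_diff del: Max_insert)
    ultimately show ?thesis by linarith
  qed
  then show ?thesis unfolding ideal_age_def by linarith
qed

lemma ideal_age_average:
  assumes "(\<lambda>m. (\<Sum>l=1..m\<^sup>2. real (gp l) * real (min (D l) n)) / real (m\<^sup>2)) \<longlonglongrightarrow> c"
  shows "((\<lambda>t. integral {0..t} ideal_age / t) \<longlongrightarrow> real n / 2 + c) at_top"
proof (rule tendsto_of_tendsto_along_squares)
  show "integral {0..s} ideal_age \<le> integral {0..t} ideal_age" if "0 \<le> s" "s \<le> t" for s t
    using that by (intro integral_subset_le ideal_age_integrable) (auto intro: ideal_age_nonneg)
  show "0 \<le> integral {0..t} ideal_age" if "0 \<le> t" for t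
    by (intro integral_nonneg ideal_age_integrable ideal_age_nonneg) auto
  show "0 < real n" using n_pos by simp
  let ?S = "\<lambda>m. \<Sum>l=1..m\<^sup>2. real (gp l) * real (min (D l) n)"
  show "(\<lambda>m. integral {0..real (m\<^sup>2) * real n} ideal_age / (real (m\<^sup>2) * real n))
      \<longlonglongrightarrow> real n / 2 + c"
  proof (rule Lim_transform_eventually)
    show "(\<lambda>m. real n / 2 + ?S m / real (m\<^sup>2)) \<longlonglongrightarrow> real n / 2 + c"
      by (intro tendsto_intros assms)
    show "\<forall>\<^sub>F m in sequentially. real n / 2 + ?S m / real (m\<^sup>2)
        = integral {0..real (m\<^sup>2) * real n} ideal_age / (real (m\<^sup>2) * real n)"
      using eventually_gt_at_top[of 0]
    proof eventually_elim
      case (elim m)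
      have "integral {0..real (m\<^sup>2) * real n} ideal_age = real (m\<^sup>2) * (real n)\<^sup>2 / 2 + real n * ?S m"
        using integral_unique[OF ideal_age_integral[of "m\<^sup>2"]] by simp
      then show ?case using elim n_pos by (simp add: field_simps power2_eq_square)
    qed
  qed
qed

text \<open>The age differs from \<open>ideal_age\<close> by the constant
  \<open>frac (- t0) - 1\<close> and, before the first decoding at time \<open>s\<close>, by a
  further constant \<open>q\<close>. The latter adds the fixed amount \<open>q * s\<close> to the
  integral, which disappears in the average. The block \<open>l'\<close> guarantees that a first
  decoding exists.\<close>

lemma has_average_age:
  fixes G :: "nat \<Rightarrow> nat \<Rightarrow> ('a::field)^('k::finite)"
  assumes G: "\<And>l. D l = delay n (\<lambda>j. (G l j, X (channel_use n l j)))"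
    and lim: "(\<lambda>m. (\<Sum>l=1..m\<^sup>2. real (gp l) * real (min (D l) n)) / real (m\<^sup>2)) \<longlonglongrightarrow> c"
    and ex: "1 \<le> l'" "D l' \<le> n"
  shows "has_average (age n t0 a0 G X) (real n / 2 + c + frac (- t0) - 1)"
proof -
  define l0 where "l0 = (LEAST l. 1 \<le> l \<and> D l \<le> n)"
  define s where "s = real (channel_use n l0 (D l0))"
  \<comment> \<open>Chosen so that \<open>a0 + t\<close> equals
    \<open>(t + real n) + (frac (- t0) - 1) + q\<close>, where \<open>t + real n\<close> is the
    ideal age while nothing but block 0 is decoded.\<close>
  define q where "q = a0 - real n - frac (- t0) + 1"
  have l0: "1 \<le> l0" "D l0 \<le> n" using LeastI[of "\<lambda>l. 1 \<le> l \<and> D l \<le> n" l'] ex by (auto simp: l0_def)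
  have decoded_by: "decoded_by n G X t = decoded t" for t
    unfolding decoded_by_def decoded_def
    by (auto simp: is_decoded_iff_delay decoding_time_eq_delay G)
  have empty: "decoded t = {} \<longleftrightarrow> t < s" for t
  proof
    assume "decoded t = {}"
    then have "l0 \<notin> decoded t" by simp
    then show "t < s" using l0 by (auto simp: decoded_def s_def)
  next
    assume t: "t < s"
    show "decoded t = {}"
    proof (rule ccontr)
      assume "decoded t \<noteq> {}"
      then obtain j where j: "1 \<le> j" "D j \<le> n" "real (channel_use n j (D j)) \<le> t"
        by (auto simp: decoded_def)
      then have "l0 \<le> j" unfolding l0_def by (intro Least_le) auto
      moreover have "channel_use n l0 (D l0) \<le> channel_use n j (D j)" if "l0 < j"
        using channel_use_mono[OF l0(1) that l0(2)] by (simp add: channel_use_def)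
      ultimately have "channel_use n l0 (D l0) \<le> channel_use n j (D j)"
        by (cases "l0 = j") auto
      then show False using t j(3) unfolding s_def by linarith
    qed
  qed
  have age: "age n t0 a0 G X t
      = ideal_age t + (frac (- t0) - 1) + (if t < s then q else 0)" for t
  proof (cases "t < s")
    case True
    then have "decoded t = {}" using empty by simp
    then show ?thesis using True by (simp add: age_def decoded_by ideal_age_def q_def)
  next
    case False
    then have ne: "decoded t \<noteq> {}" using empty by simp
    let ?l = "Max (decoded t)"
    have l: "1 \<le> ?l" using Max_in[OF finite_decoded ne] by (auto simp: decoded_def)
    \<comment> \<open>Only the fractional part of \<open>- t0\<close> survives: the integer shift
      passes through the floor, and the floor of \<open>- t0\<close> plus \<open>t0\<close> is
      \<open>- frac (- t0)\<close>.\<close>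
    have "message_index n t0 ?l = \<lfloor>- t0 + of_int ((int ?l - 1) * int n + 1)\<rfloor>"
      by (simp add: message_index_def)
    also have "\<dots> = \<lfloor>- t0\<rfloor> + ((int ?l - 1) * int n + 1)" by (rule floor_add_int[symmetric])
    finally have "real_of_int (message_index n t0 ?l) + t0 = (real ?l - 1) * real n + 1 - frac (- t0)"
      by (simp add: frac_def)
    moreover have "Max (insert 0 (decoded t)) = ?l"
      using finite_decoded ne by simp
    ultimately show ?thesis using False ne
      by (simp add: age_def decoded_by ideal_age_def algebra_simps)
  qed
  have s: "0 \<le> s" by (simp add: s_def)
  have I: "(age n t0 a0 G X has_integral
      integral {0..t} ideal_age + (frac (- t0) - 1) * t + q * s) {0..t}" if t: "s \<le> t" for t
  proof -
    have "((\<lambda>t. q) has_integral q * s) {0..s}"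
      using has_integral_const_real[of q 0 s] s by (simp add: mult.commute)
    then have "((\<lambda>t. if t < s then q else 0) has_integral q * s) {0..s}"
      by (rule has_integral_spike_finite[of "{s}", rotated 2]) auto
    moreover have "((\<lambda>t. if t < s then q else 0) has_integral 0) {s..t}"
      by (rule has_integral_is_0) auto
    ultimately have "((\<lambda>t. if t < s then q else 0) has_integral q * s + 0) {0..t}"
      using s t by (intro has_integral_combine[of 0 s t])
    moreover have "((\<lambda>_. frac (- t0) - 1) has_integral (frac (- t0) - 1) * t) {0..t}"
      using has_integral_const_real[of "frac (- t0) - 1" 0 t] s t by (simp add: mult.commute)
    moreover have "(ideal_age has_integral integral {0..t} ideal_age) {0..t}"
      using ideal_age_integrable by (rule integrable_integral)
    ultimately show ?thesis
      unfolding age[abs_def] by (auto intro!: has_integral_add)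
  qed
  show ?thesis unfolding has_average_def
  proof (intro conjI allI impI)
    fix t :: real assume "0 \<le> t"
    show "age n t0 a0 G X integrable_on {0..t}"
      using integrable_on_subinterval[OF has_integral_integrable[OF I[of "max s t"]], of 0 t] by auto
  next
    have "((\<lambda>t. integral {0..t} ideal_age / t + (frac (- t0) - 1) + q * s / t)
        \<longlongrightarrow> (real n / 2 + c) + (frac (- t0) - 1) + 0) at_top"
      using ideal_age_average[OF lim]
      by (intro tendsto_add tendsto_const)
        (auto intro!: tendsto_divide_0[OF tendsto_const] filterlim_at_top_imp_at_infinity filterlim_ident)
    then have "((\<lambda>t. 1 / t * integral {0..t} (age n t0 a0 G X))
        \<longlongrightarrow> (real n / 2 + c) + (frac (- t0) - 1) + 0) at_top"
    proof (rule Lim_transform_eventually)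
      show "\<forall>\<^sub>F t in at_top. integral {0..t} ideal_age / t + (frac (- t0) - 1) + q * s / t
          = 1 / t * integral {0..t} (age n t0 a0 G X)"
        using eventually_ge_at_top[of s] eventually_gt_at_top[of 0]
      proof eventually_elim
        case (elim t)
        show ?case unfolding integral_unique[OF I[OF elim(1)]] using elim by (simp add: field_simps)
      qed
    qed
    then show "((\<lambda>t. 1 / t * integral {0..t} (age n t0 a0 G X))
        \<longlongrightarrow> real n / 2 + c + frac (- t0) - 1) at_top"
      by (simp add: algebra_simps)
  qed
qed

end

section \<open>Strong law for the gaps\<close>

text \<open>The second moments have a finite sum, so by exchanging sum and integral the series of
  squares converges almost surely and its terms tend to 0. At \<open>m = 0\<close> the bound is 0,
  since division by 0 gives 0; the averages used later have \<open>real (m\<^sup>2)\<close> as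
  denominator and are 0 there as well.\<close>

lemma (in prob_space) AE_tendsto_0_of_second_moment:
  fixes X :: "nat \<Rightarrow> 'a \<Rightarrow> real"
  assumes int: "\<And>m. integrable M (\<lambda>\<omega>. (X m \<omega>)\<^sup>2)"
    and le: "\<And>m. expectation (\<lambda>\<omega>. (X m \<omega>)\<^sup>2) \<le> C / (real m)\<^sup>2"
  shows "AE \<omega> in M. (\<lambda>m. X m \<omega>) \<longlonglongrightarrow> 0"
proof -
  have "summable (\<lambda>m. C * (1 / (real m)\<^sup>2))"
    using inverse_power_summable[of 2, where 'a = real]
    by (intro summable_mult) (simp add: inverse_eq_divide)
  then have sum: "summable (\<lambda>m. C / (real m)\<^sup>2)" by simp
  have meas: "(\<lambda>\<omega>. ennreal ((X m \<omega>)\<^sup>2)) \<in> borel_measurable M" for m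
    using borel_measurable_integrable[OF int[of m]] by measurable
  have "(\<integral>\<^sup>+\<omega>. (\<Sum>m. ennreal ((X m \<omega>)\<^sup>2)) \<partial>M) = (\<Sum>m. \<integral>\<^sup>+\<omega>. ennreal ((X m \<omega>)\<^sup>2) \<partial>M)"
    by (rule nn_integral_suminf[OF meas])
  also have "\<dots> = (\<Sum>m. ennreal (expectation (\<lambda>\<omega>. (X m \<omega>)\<^sup>2)))"
    by (subst nn_integral_eq_integral[OF int]) auto
  also have "\<dots> \<le> (\<Sum>m. ennreal (C / (real m)\<^sup>2))"
    using le by (intro suminf_le ennreal_leI) auto
  also have "\<dots> < \<infinity>"
  proof -
    have nonneg: "0 \<le> C / (real m)\<^sup>2" for m
    proof -
      have "0 \<le> expectation (\<lambda>\<omega>. (X m \<omega>)\<^sup>2)" by simp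
      then show ?thesis using le[of m] by linarith
    qed
    show ?thesis unfolding suminf_ennreal2[OF nonneg sum] by simp
  qed
  finally have "(\<integral>\<^sup>+\<omega>. (\<Sum>m. ennreal ((X m \<omega>)\<^sup>2)) \<partial>M) \<noteq> \<infinity>" by (rule less_imp_neq)
  then have "AE \<omega> in M. (\<Sum>m. ennreal ((X m \<omega>)\<^sup>2)) \<noteq> \<infinity>"
    by (intro nn_integral_noteq_infinite borel_measurable_suminf_order meas)
  then show ?thesis
  proof eventually_elim
    case (elim \<omega>)
    then have "summable (\<lambda>m. (X m \<omega>)\<^sup>2)"
      by (intro summable_suminf_not_top) auto
    then have "(\<lambda>m. sqrt ((X m \<omega>)\<^sup>2)) \<longlonglongrightarrow> sqrt 0"
      by (intro tendsto_real_sqrt summable_LIMSEQ_zero)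
    then show ?case by (simp add: tendsto_rabs_zero_iff)
  qed
qed

locale iid_delays = prob_space M for M :: "'w measure" +
  fixes n :: nat and D :: "nat \<Rightarrow> 'w \<Rightarrow> nat"
  assumes indep: "indep_vars (\<lambda>_. count_space UNIV) D {1..}"
    and ident: "\<And>l. 1 \<le> l \<Longrightarrow> distr M (count_space UNIV) (D l) = distr M (count_space UNIV) (D 1)"
    and D_le: "\<And>l \<omega>. D l \<omega> \<le> Suc n"
    and pos: "0 < prob {\<omega> \<in> space M. D 1 \<omega> \<le> n}"
begin

definition E :: "(nat \<Rightarrow> real) \<Rightarrow> real" where
  "E u = expectation (\<lambda>\<omega>. u (D 1 \<omega>))"

abbreviation seq :: "'w \<Rightarrow> nat \<Rightarrow> nat" where
  "seq \<omega> \<equiv> \<lambda>l. D l \<omega>"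

text \<open>Stands for measurability with respect to the first \<open>L\<close> delays. On discrete
  spaces this amounts to invariance under restriction, which pointwise operations preserve
  trivially.\<close>

definition history :: "nat \<Rightarrow> ((nat \<Rightarrow> nat) \<Rightarrow> real) \<Rightarrow> bool" where
  "history L f \<longleftrightarrow> (\<forall>w. f (restrict w {1..L}) = f w)"

lemma D_measurable: "1 \<le> l \<Longrightarrow> D l \<in> measurable M (count_space UNIV)"
  using indep by (auto simp: indep_vars_def)

lemma expectation_D: "1 \<le> l \<Longrightarrow> expectation (\<lambda>\<omega>. u (D l \<omega>)) = E u" for u :: "nat \<Rightarrow> real"
proof -
  assume l: "1 \<le> l"
  have "expectation (\<lambda>\<omega>. u (D l \<omega>)) = (\<integral>d. u d \<partial>distr M (count_space UNIV) (D l))"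
    using D_measurable[OF l] by (subst integral_distr) auto
  also have "\<dots> = (\<integral>d. u d \<partial>distr M (count_space UNIV) (D 1))" by (simp only: ident[OF l])
  also have "\<dots> = E u"
    unfolding E_def using D_measurable[of 1] by (subst integral_distr) auto
  finally show ?thesis .
qed

text \<open>A finite product of countable discrete spaces is discrete, so every real function of
  finitely many delays is measurable.\<close>

lemma PiM_nat: "PiM {1..L} (\<lambda>_. count_space UNIV) = count_space (PiE {1..L} (\<lambda>_::nat. UNIV :: nat set))"
  by (intro count_space_PiM_finite) auto

lemma history_measurable_PiM:
  "f \<in> borel_measurable (PiM {1..L} (\<lambda>_. count_space (UNIV :: nat set)))"
  for f :: "(nat \<Rightarrow> nat) \<Rightarrow> real"
  unfolding PiM_nat by simp

text \<open>Delays are at most \<open>Suc n\<close>, so \<open>f\<close> takes finitely many values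
  on them; the sum of the absolute values is a crude uniform bound.\<close>

lemma history_integrable:
  assumes "history L f"
  shows "integrable M (\<lambda>\<omega>. f (seq \<omega>))"
proof -
  have eq: "(\<lambda>\<omega>. f (seq \<omega>)) = (\<lambda>\<omega>. f (\<lambda>l\<in>{1..L}. D l \<omega>))"
    using assms by (simp add: history_def)
  let ?W = "f ` (PiE {1..L} (\<lambda>_. {..Suc n}))"
  have fin: "finite ?W" by (intro finite_imageI finite_PiE) auto
  have bd: "\<bar>f (\<lambda>l\<in>{1..L}. D l \<omega>)\<bar> \<le> (\<Sum>y\<in>?W. \<bar>y\<bar>)" for \<omega>
    using D_le by (intro member_le_sum[of _ _ abs] fin imageI) auto
  have meas: "(\<lambda>\<omega>. \<lambda>l\<in>{1..L}. D l \<omega>) \<in> measurable M (PiM {1..L} (\<lambda>_. count_space UNIV))"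
    by (intro measurable_restrict D_measurable) auto
  show ?thesis unfolding eq
    using bd measurable_compose[OF meas history_measurable_PiM]
    by (intro integrable_const_bound[where B = "\<Sum>y\<in>?W. \<bar>y\<bar>"]) auto
qed

lemma history_mono: "history L f \<Longrightarrow> L \<le> L' \<Longrightarrow> history L' f"
proof -
  assume f: "history L f" "L \<le> L'"
  have "f (restrict w {1..L'}) = f w" for w
  proof -
    have "restrict (restrict w {1..L'}) {1..L} = restrict w {1..L}" using f(2) by auto
    then show ?thesis using f(1) unfolding history_def by metis
  qed
  then show ?thesis by (simp add: history_def)
qed

lemma history_coord: "1 \<le> l \<Longrightarrow> l \<le> L \<Longrightarrow> history L (\<lambda>w. u (w l))"
  by (simp add: history_def)

lemma history_mult: "history L f \<Longrightarrow> history L h \<Longrightarrow> history L (\<lambda>w. f w * h w)"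
  by (simp add: history_def)

lemma history_power: "history L f \<Longrightarrow> history L (\<lambda>w. f w ^ i)"
  by (simp add: history_def)

lemma history_sum: "(\<And>i. i \<in> I \<Longrightarrow> history L (f i)) \<Longrightarrow> history L (\<lambda>w. \<Sum>i\<in>I. f i w)"
  by (simp add: history_def)

text \<open>Takes the place of conditioning on the past: the restrictions to the disjoint index sets
  \<open>{1..L}\<close> and \<open>{Suc L}\<close> are independent, so a factor that depends on the
  next delay splits off.\<close>

lemma history_next:
  assumes f: "history L f"
  shows "expectation (\<lambda>\<omega>. f (seq \<omega>) * u (D (Suc L) \<omega>)) = expectation (\<lambda>\<omega>. f (seq \<omega>)) * E u"
proof -
  have "indep_var (PiM {1..L} (\<lambda>_. count_space UNIV)) (\<lambda>\<omega>. \<lambda>l\<in>{1..L}. D l \<omega>)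
      (PiM {Suc L} (\<lambda>_. count_space UNIV)) (\<lambda>\<omega>. \<lambda>l\<in>{Suc L}. D l \<omega>)"
    by (rule indep_var_restrict[OF indep]) auto
  then have "indep_var borel (f \<circ> (\<lambda>\<omega>. \<lambda>l\<in>{1..L}. D l \<omega>))
      borel ((\<lambda>w. u (w (Suc L))) \<circ> (\<lambda>\<omega>. \<lambda>l\<in>{Suc L}. D l \<omega>))"
  proof (rule indep_var_compose[OF _ history_measurable_PiM])
    show "(\<lambda>w. u (w (Suc L))) \<in> borel_measurable (PiM {Suc L} (\<lambda>_. count_space UNIV))"
      by (rule measurable_compose[OF measurable_component_singleton]) auto
  qed
  moreover have "(f \<circ> (\<lambda>\<omega>. \<lambda>l\<in>{1..L}. D l \<omega>)) = (\<lambda>\<omega>. f (seq \<omega>))"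
    using f by (auto simp: history_def)
  moreover have "((\<lambda>w. u (w (Suc L))) \<circ> (\<lambda>\<omega>. \<lambda>l\<in>{Suc L}. D l \<omega>)) = (\<lambda>\<omega>. u (D (Suc L) \<omega>))"
    by auto
  ultimately have "indep_var borel (\<lambda>\<omega>. f (seq \<omega>)) borel (\<lambda>\<omega>. u (D (Suc L) \<omega>))" by simp
  then have "expectation (\<lambda>\<omega>. f (seq \<omega>) * u (D (Suc L) \<omega>))
      = expectation (\<lambda>\<omega>. f (seq \<omega>)) * expectation (\<lambda>\<omega>. u (D (Suc L) \<omega>))"
    using history_integrable[OF f]
      history_integrable[OF history_coord[of "Suc L" "Suc L" u]]
    by (intro indep_var_lebesgue_integral) auto
  then show ?thesis by (simp add: expectation_D)
qed

section \<open>Moments of the gaps and of weighted sums\<close>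

definition g :: "nat \<Rightarrow> (nat \<Rightarrow> nat) \<Rightarrow> real" where
  "g l w = real (gap (\<lambda>l. w l \<le> n) l)"

definition p :: real where "p = prob {\<omega> \<in> space M. D 1 \<omega> \<le> n}"

abbreviation miss :: "nat \<Rightarrow> real" where
  "miss d \<equiv> of_bool (n < d)"

lemma p_pos: "0 < p" using pos by (simp add: p_def)

lemma E_hit: "E (\<lambda>d. of_bool (d \<le> n)) = p"
proof -
  have "E (\<lambda>d. of_bool (d \<le> n)) = expectation (indicator {\<omega> \<in> space M. D 1 \<omega> \<le> n})"
    unfolding E_def by (intro Bochner_Integration.integral_cong) auto
  also have "\<dots> = p" using D_measurable[of 1] by (simp add: p_def)
  finally show ?thesis .
qed

lemma D_integrable: "1 \<le> l \<Longrightarrow> integrable M (\<lambda>\<omega>. u (D l \<omega>))" for u :: "nat \<Rightarrow> real"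
  using history_integrable[OF history_coord[of l l u]] by simp

lemma E_miss: "E miss = 1 - p"
proof -
  have "E miss = expectation (\<lambda>\<omega>. 1 - of_bool (D 1 \<omega> \<le> n))"
    unfolding E_def by (intro Bochner_Integration.integral_cong) auto
  also have "\<dots> = 1 - E (\<lambda>d. of_bool (d \<le> n))"
    unfolding E_def using D_integrable[of 1 "\<lambda>d. of_bool (d \<le> n)"] prob_space by simp
  also have "\<dots> = 1 - p" by (simp only: E_hit)
  finally show ?thesis .
qed

text \<open>With the case distinction written as a product, \<open>history_next\<close> turns the
  recursion into one for expectations.\<close>

lemma g_Suc: "g (Suc l) w = 1 + g l w * miss (w l)"
  by (auto simp: g_def)

lemma g_1: "g (Suc 0) w = 1"
  by (simp add: g_def)

lemma history_g:
  assumes "1 \<le> l" "l \<le> Suc L"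
  shows "history L (g l)"
proof -
  obtain l' where l: "l = Suc l'" using assms(1) by (cases l) auto
  have "real (gap (\<lambda>j. restrict w {1..L} j \<le> n) l) = real (gap (\<lambda>j. w j \<le> n) l)" for w
    unfolding l using assms(2) l by (subst gap_Suc_cong[of l' _ "\<lambda>j. w j \<le> n"]) auto
  then show ?thesis unfolding history_def g_def by blast
qed

text \<open>With r = 1 - p < 1, the first moment obeys a' = 1 + r a and the second b' = 1 + 2 r a +
  r b. Upper bounds by the fixed points of such contractions are preserved in the induction.\<close>

lemma g_second_moment:
  obtains C where "\<And>L. expectation (\<lambda>\<omega>. (g (Suc L) (seq \<omega>))\<^sup>2) \<le> C" "0 \<le> C"
proof -
  define r where "r = 1 - p"
  \<comment> \<open>The fixed point of b = 1 + 2 r / p + r b, where 1 / p is the fixed point that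
    bounds the first moment.\<close>
  define C where "C = (1 + 2 * r / p) / p"
  have p1: "p \<le> 1" by (simp add: p_def)
  then have r: "0 \<le> r" by (simp add: r_def)
  have C1: "1 / p = 1 + r * (1 / p)" using p_pos by (simp add: r_def field_simps)
  have C2: "C = 1 + 2 * r / p + r * C" using p_pos by (simp add: r_def C_def field_simps)
  have hg: "history L (g (Suc L))" for L by (intro history_g) auto
  have int1: "integrable M (\<lambda>\<omega>. g (Suc L) (seq \<omega>) * miss (D (Suc L) \<omega>))" for L
    by (rule history_integrable[of "Suc L"]) (intro history_mult history_g history_coord; simp)
  have int2: "integrable M (\<lambda>\<omega>. (g (Suc L) (seq \<omega>))\<^sup>2 * miss (D (Suc L) \<omega>))" for L
    by (rule history_integrable[of "Suc L"]) (intro history_mult history_power history_g history_coord; simp)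
  have miss1: "expectation (\<lambda>\<omega>. g (Suc L) (seq \<omega>) * miss (D (Suc L) \<omega>))
      = expectation (\<lambda>\<omega>. g (Suc L) (seq \<omega>)) * r" for L
    using history_next[OF hg, where u = miss] by (simp add: E_miss r_def)
  have miss2: "expectation (\<lambda>\<omega>. (g (Suc L) (seq \<omega>))\<^sup>2 * miss (D (Suc L) \<omega>))
      = expectation (\<lambda>\<omega>. (g (Suc L) (seq \<omega>))\<^sup>2) * r" for L
    using history_next[OF history_power[OF hg], where u = miss] by (simp add: E_miss r_def)
  have first: "expectation (\<lambda>\<omega>. g (Suc L) (seq \<omega>)) \<le> 1 / p" for L
  proof (induction L)
    case 0
    then show ?case using p_pos p1 prob_space by (simp add: g_1)
  next
    case (Suc L)
    have "expectation (\<lambda>\<omega>. g (Suc (Suc L)) (seq \<omega>))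
        = 1 + expectation (\<lambda>\<omega>. g (Suc L) (seq \<omega>) * miss (D (Suc L) \<omega>))"
      unfolding g_Suc[of "Suc L"]
      using int1 prob_space by simp
    also have "\<dots> = 1 + r * expectation (\<lambda>\<omega>. g (Suc L) (seq \<omega>))"
      by (simp add: miss1)
    also have "\<dots> \<le> 1 + r * (1 / p)" using Suc r by (intro add_left_mono mult_left_mono)
    finally show ?case using C1 by linarith
  qed
  have second: "expectation (\<lambda>\<omega>. (g (Suc L) (seq \<omega>))\<^sup>2) \<le> C" for L
  proof (induction L)
    case 0
    have "1 * 1 \<le> (1 + 2 * r / p) * (1 / p)" using p_pos p1 r by (intro mult_mono) auto
    then show ?case using prob_space by (simp add: g_1 C_def)
  next
    case (Suc L)
    \<comment> \<open>The square of an indicator is the indicator, so \<open>miss\<close> enters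
      only linearly.\<close>
    have "(g (Suc (Suc L)) w)\<^sup>2
        = 1 + (2 * (g (Suc L) w * miss (w (Suc L))) + (g (Suc L) w)\<^sup>2 * miss (w (Suc L)))" for w
      unfolding g_Suc[of "Suc L"] by (auto simp: power2_eq_square algebra_simps)
    then have "expectation (\<lambda>\<omega>. (g (Suc (Suc L)) (seq \<omega>))\<^sup>2)
        = 1 + (2 * expectation (\<lambda>\<omega>. g (Suc L) (seq \<omega>) * miss (D (Suc L) \<omega>))
            + expectation (\<lambda>\<omega>. (g (Suc L) (seq \<omega>))\<^sup>2 * miss (D (Suc L) \<omega>)))"
      using int1 int2 prob_space by simp
    also have "\<dots> = 1 + 2 * (r * expectation (\<lambda>\<omega>. g (Suc L) (seq \<omega>)))
        + r * expectation (\<lambda>\<omega>. (g (Suc L) (seq \<omega>))\<^sup>2)"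
      by (simp add: miss1 miss2)
    also have "\<dots> \<le> 1 + 2 * (r * (1 / p)) + r * C"
      using Suc r first[of L] by (intro add_mono mult_left_mono order_refl) auto
    finally show ?case using C2 by simp
  qed
  show ?thesis using second p_pos r by (intro that[of C]) (auto simp: C_def)
qed

text \<open>The partial sum and the next gap are determined by earlier blocks, so each new cross
  term factors through \<open>E y = 0\<close>. What remains is one new square, whose mean is bounded
  uniformly by \<open>g_second_moment\<close>.\<close>

lemma weighted_sum_second_moment:
  assumes "E y = 0"
  obtains C where "\<And>L. expectation (\<lambda>\<omega>. (\<Sum>l=1..L. g l (seq \<omega>) * y (D l \<omega>))\<^sup>2) \<le> C * real L"
proof -
  obtain C where C: "\<And>L. expectation (\<lambda>\<omega>. (g (Suc L) (seq \<omega>))\<^sup>2) \<le> C" "0 \<le> C"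
    using g_second_moment by blast
  define S where "S = (\<lambda>L w. \<Sum>l=1..L. g l w * y (w l))"
  have hS: "history L (S L)" for L
    unfolding S_def by (intro history_sum history_mult history_g history_coord) auto
  have "expectation (\<lambda>\<omega>. (S L (seq \<omega>))\<^sup>2) \<le> C * E (\<lambda>d. (y d)\<^sup>2) * real L" for L
  proof (induction L)
    case 0
    then show ?case by (simp add: S_def)
  next
    case (Suc L)
    let ?G = "g (Suc L)"
    have h1: "history L (\<lambda>w. S L w * ?G w)" by (intro history_mult hS history_g) auto
    have h2: "history L (\<lambda>w. (?G w)\<^sup>2)" by (intro history_power history_g) auto
    have h3: "history L (\<lambda>w. (S L w)\<^sup>2)" by (intro history_power hS)
    have int1: "integrable M (\<lambda>\<omega>. S L (seq \<omega>) * ?G (seq \<omega>) * y (D (Suc L) \<omega>))"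
      by (rule history_integrable[OF history_mult[OF history_mono[OF h1, of "Suc L"] history_coord]]) auto
    have int2: "integrable M (\<lambda>\<omega>. (?G (seq \<omega>))\<^sup>2 * (y (D (Suc L) \<omega>))\<^sup>2)"
      by (rule history_integrable[OF history_mult[OF history_mono[OF h2, of "Suc L"]
        history_coord[where u = "\<lambda>d. (y d)\<^sup>2"]]]) auto
    have Ey: "0 \<le> E (\<lambda>d. (y d)\<^sup>2)" unfolding E_def by simp
    have "(S (Suc L) w)\<^sup>2 = (S L w)\<^sup>2 + (2 * (S L w * ?G w * y (w (Suc L)))
        + (?G w)\<^sup>2 * (y (w (Suc L)))\<^sup>2)" for w
      by (simp add: S_def power2_eq_square algebra_simps)
    then have "expectation (\<lambda>\<omega>. (S (Suc L) (seq \<omega>))\<^sup>2) = expectation (\<lambda>\<omega>. (S L (seq \<omega>))\<^sup>2)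
        + (2 * expectation (\<lambda>\<omega>. S L (seq \<omega>) * ?G (seq \<omega>) * y (D (Suc L) \<omega>))
        + expectation (\<lambda>\<omega>. (?G (seq \<omega>))\<^sup>2 * (y (D (Suc L) \<omega>))\<^sup>2))"
      using history_integrable[OF h3] int1 int2 by simp
    also have "\<dots> = expectation (\<lambda>\<omega>. (S L (seq \<omega>))\<^sup>2)
        + expectation (\<lambda>\<omega>. (?G (seq \<omega>))\<^sup>2) * E (\<lambda>d. (y d)\<^sup>2)"
      using history_next[OF h1, where u = y] history_next[OF h2, where u = "\<lambda>d. (y d)\<^sup>2"] assms by simp
    also have "\<dots> \<le> C * E (\<lambda>d. (y d)\<^sup>2) * real L + C * E (\<lambda>d. (y d)\<^sup>2)"
      using Suc C Ey by (intro add_mono mult_right_mono) auto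
    finally show ?case by (simp add: algebra_simps)
  qed
  then show ?thesis by (intro that) (simp add: S_def)
qed

text \<open>Centring \<open>u\<close> by a multiple of the hit indicator, not by its mean, leaves
  the weighted sum of hits, which \<open>sum_gap_hits\<close> gives exactly; centring by a constant
  would leave the sum of the gaps, whose growth is not known beforehand. The second limit disposes
  of the error term and later produces a decoded block.\<close>

lemma AE_gap_average:
  "AE \<omega> in M. (\<lambda>m. (\<Sum>l=1..m\<^sup>2. real (gap (\<lambda>l. D l \<omega> \<le> n) l) * u (D l \<omega>)) / real (m\<^sup>2)) \<longlonglongrightarrow> E u / p
    \<and> (\<lambda>m. real (gap (\<lambda>l. D l \<omega> \<le> n) (Suc (m\<^sup>2))) / real (m\<^sup>2)) \<longlonglongrightarrow> 0"
proof -
  define c where "c = E u / p"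
  define y where "y = (\<lambda>d. u d - c * of_bool (d \<le> n))"
  define S where "S = (\<lambda>L w. \<Sum>l=1..L. g l w * y (w l))"
  have "E y = E u - c * E (\<lambda>d. of_bool (d \<le> n))"
    using D_integrable[of 1 u] D_integrable[of 1 "\<lambda>d. of_bool (d \<le> n)"]
    by (simp add: y_def E_def)
  then have "E y = 0" using p_pos by (simp add: E_hit c_def)
  then obtain C where C: "\<And>L. expectation (\<lambda>\<omega>. (S L (seq \<omega>))\<^sup>2) \<le> C * real L"
    unfolding S_def using weighted_sum_second_moment by blast
  obtain C' where C': "\<And>L. expectation (\<lambda>\<omega>. (g (Suc L) (seq \<omega>))\<^sup>2) \<le> C'" "0 \<le> C'"
    using g_second_moment by blast
  have hS: "history L (S L)" for L
    unfolding S_def by (intro history_sum history_mult history_g history_coord) auto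
  have "AE \<omega> in M. (\<lambda>m. S (m\<^sup>2) (seq \<omega>) / real (m\<^sup>2)) \<longlonglongrightarrow> 0"
  proof (rule AE_tendsto_0_of_second_moment)
    fix m :: nat
    show "integrable M (\<lambda>\<omega>. (S (m\<^sup>2) (seq \<omega>) / real (m\<^sup>2))\<^sup>2)"
      unfolding power_divide
      using history_integrable[OF history_power[OF hS[of "m\<^sup>2"], of 2]] by (intro integrable_divide) auto
    have "expectation (\<lambda>\<omega>. (S (m\<^sup>2) (seq \<omega>) / real (m\<^sup>2))\<^sup>2)
        = expectation (\<lambda>\<omega>. (S (m\<^sup>2) (seq \<omega>))\<^sup>2) / (real (m\<^sup>2))\<^sup>2"
      unfolding power_divide by simp
    also have "\<dots> \<le> C * real (m\<^sup>2) / (real (m\<^sup>2))\<^sup>2" by (intro divide_right_mono C) auto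
    also have "\<dots> = C / (real m)\<^sup>2" by (simp add: power2_eq_square)
    finally show "expectation (\<lambda>\<omega>. (S (m\<^sup>2) (seq \<omega>) / real (m\<^sup>2))\<^sup>2) \<le> C / (real m)\<^sup>2" .
  qed
  moreover have "AE \<omega> in M. (\<lambda>m. g (Suc (m\<^sup>2)) (seq \<omega>) / real (m\<^sup>2)) \<longlonglongrightarrow> 0"
  proof (rule AE_tendsto_0_of_second_moment)
    fix m :: nat
    show "integrable M (\<lambda>\<omega>. (g (Suc (m\<^sup>2)) (seq \<omega>) / real (m\<^sup>2))\<^sup>2)"
      unfolding power_divide
      using history_integrable[OF history_power[OF history_g[of "Suc (m\<^sup>2)" "m\<^sup>2"], of 2]]
      by (intro integrable_divide) auto
    have "expectation (\<lambda>\<omega>. (g (Suc (m\<^sup>2)) (seq \<omega>) / real (m\<^sup>2))\<^sup>2)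
        = expectation (\<lambda>\<omega>. (g (Suc (m\<^sup>2)) (seq \<omega>))\<^sup>2) / (real (m\<^sup>2))\<^sup>2"
      unfolding power_divide by simp
    also have "\<dots> \<le> C' / (real (m\<^sup>2))\<^sup>2" by (intro divide_right_mono C') auto
    \<comment> \<open>The bound is of order 1/m^4 and is weakened to the form that the convergence
      criterion expects.\<close>
    also have "\<dots> \<le> C' / (real m)\<^sup>2"
    proof (cases "m = 0")
      case False
      have "(real m)\<^sup>2 \<le> (real (m\<^sup>2))\<^sup>2" using False
        by (intro power_mono) (auto simp: power2_eq_square)
      then show ?thesis using False C'(2) by (intro divide_left_mono) auto
    qed simp
    finally show "expectation (\<lambda>\<omega>. (g (Suc (m\<^sup>2)) (seq \<omega>) / real (m\<^sup>2))\<^sup>2) \<le> C' / (real m)\<^sup>2" .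
  qed
  ultimately show ?thesis
  proof eventually_elim
    case (elim \<omega>)
    let ?w = "seq \<omega>"
    have sum: "(\<Sum>l=1..L. g l ?w * u (?w l)) = S L ?w + c * (real L + 1 - g (Suc L) ?w)" for L
    proof -
      have "real ((\<Sum>l=1..L. gap (\<lambda>l. ?w l \<le> n) l * of_bool (?w l \<le> n)) + gap (\<lambda>l. ?w l \<le> n) (Suc L))
          = real (Suc L)"
        by (simp only: sum_gap_hits)
      then have "(\<Sum>l=1..L. g l ?w * of_bool (?w l \<le> n)) = real L + 1 - g (Suc L) ?w"
        by (simp add: g_def del: gap.simps)
      moreover have "(\<Sum>l=1..L. g l ?w * u (?w l))
          = S L ?w + c * (\<Sum>l=1..L. g l ?w * of_bool (?w l \<le> n))"
        unfolding S_def y_def sum_distrib_left sum.distrib[symmetric]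
        by (intro sum.cong) (auto simp: algebra_simps)
      ultimately show ?thesis by simp
    qed
    have "(\<lambda>m. S (m\<^sup>2) ?w / real (m\<^sup>2)
        + c * (1 + 1 / real (m\<^sup>2) - g (Suc (m\<^sup>2)) ?w / real (m\<^sup>2))) \<longlonglongrightarrow> 0 + c * (1 + 0 - 0)"
      by (intro tendsto_intros elim) real_asymp
    then have "(\<lambda>m. (\<Sum>l=1..m\<^sup>2. g l ?w * u (?w l)) / real (m\<^sup>2)) \<longlonglongrightarrow> 0 + c * (1 + 0 - 0)"
    proof (rule Lim_transform_eventually)
      show "\<forall>\<^sub>F m in sequentially. S (m\<^sup>2) ?w / real (m\<^sup>2)
        + c * (1 + 1 / real (m\<^sup>2) - g (Suc (m\<^sup>2)) ?w / real (m\<^sup>2))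
        = (\<Sum>l=1..m\<^sup>2. g l ?w * u (?w l)) / real (m\<^sup>2)"
        using eventually_gt_at_top[of 0]
      proof eventually_elim
        case (elim m)
        have "s / K + c * (1 + 1 / K - h / K) = (s + c * (K + 1 - h)) / K" if "0 < K" for s h K :: real
          using that by (simp add: field_simps)
        from this[of "real (m\<^sup>2)"] show ?case unfolding sum using elim by simp
      qed
    qed
    then show ?case using elim(2) by (simp add: g_def c_def del: gap.simps)
  qed
qed

end

section \<open>The law of the delay\<close>

text \<open>By injectivity of \<open>h\<close> the singletons \<open>{h j}\<close> are disjoint
  groups of indices; grouping by them and evaluating at \<open>h j\<close> yields the new family. It
  serves to pass from pairs \<open>(l, j)\<close> to the positions \<open>j\<close> of one
  block.\<close>

lemma (in prob_space) indep_vars_reindex: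
  assumes "indep_vars M' X I" "inj_on h L" "h ` L \<subseteq> I"
  shows "indep_vars (\<lambda>j. M' (h j)) (\<lambda>j. X (h j)) L"
proof -
  have "indep_vars (\<lambda>j. PiM {h j} M') (\<lambda>j \<omega>. \<lambda>i\<in>{h j}. X i \<omega>) L"
    using assms by (intro indep_vars_restrict[OF assms(1)])
      (auto simp: disjoint_family_on_def inj_on_def)
  then have "indep_vars (\<lambda>j. M' (h j)) (\<lambda>j \<omega>. (\<lambda>i\<in>{h j}. X i \<omega>) (h j)) L"
    by (rule indep_vars_compose2[where Y = "\<lambda>j v. v (h j)"])
      (rule measurable_component_singleton, simp)
  then show ?thesis by simp
qed

lemma measurable_PiM_finite_discrete:
  fixes f :: "('i \<Rightarrow> 'b::finite) \<Rightarrow> 'c"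
  assumes "finite J"
  shows "f \<in> measurable (PiM J (\<lambda>_. count_space UNIV)) (count_space UNIV)"
  using assms by (subst count_space_PiM_finite) (auto intro: countable_finite)

lemma measurable_delay:
  fixes V :: "nat \<Rightarrow> 'w \<Rightarrow> (('b::{field,finite})^('k::finite)) \<times> bool"
  assumes "\<And>j. j \<in> {1..n} \<Longrightarrow> V j \<in> measurable M (count_space UNIV)"
  shows "(\<lambda>\<omega>. delay n (\<lambda>j. V j \<omega>)) \<in> measurable M (count_space UNIV)"
proof -
  have "(\<lambda>\<omega>. \<lambda>j\<in>{1..n}. V j \<omega>) \<in> measurable M (PiM {1..n} (\<lambda>_. count_space UNIV))"
    by (intro measurable_restrict assms)
  then have "(\<lambda>\<omega>. delay n (\<lambda>j\<in>{1..n}. V j \<omega>)) \<in> measurable M (count_space UNIV)"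
    by (rule measurable_compose) (rule measurable_PiM_finite_discrete, simp)
  moreover have "(\<lambda>\<omega>. delay n (\<lambda>j\<in>{1..n}. V j \<omega>)) = (\<lambda>\<omega>. delay n (\<lambda>j. V j \<omega>))"
    by (intro ext delay_cong) simp
  ultimately show ?thesis by simp
qed

text \<open>The right-hand side mentions neither \<open>M\<close> nor \<open>V\<close>. All blocks
  of the scheme and the process behind \<open>B\<close> therefore share one delay law, although they
  live on different probability spaces.\<close>

lemma (in prob_space) distr_delay:
  fixes V :: "nat \<Rightarrow> 'a \<Rightarrow> (('b::{field,finite})^('k::finite)) \<times> bool"
  assumes "indep_vars (\<lambda>_. count_space UNIV) V {1..n}" "1 \<le> n"
    and law: "\<And>j. j \<in> {1..n} \<Longrightarrow> distr M (count_space UNIV) (V j) = measure_pmf P"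
  shows "distr M (count_space UNIV) (\<lambda>\<omega>. delay n (\<lambda>j. V j \<omega>))
    = distr (PiM {1..n} (\<lambda>_. measure_pmf P)) (count_space UNIV) (delay n)"
proof -
  let ?C = "PiM {1..n} (\<lambda>_::nat. count_space (UNIV :: (('b^'k) \<times> bool) set))"
  let ?r = "\<lambda>\<omega>. \<lambda>j\<in>{1..n}. V j \<omega>"
  have rv: "V j \<in> measurable M (count_space UNIV)" if "j \<in> {1..n}" for j
    using assms(1) that by (auto simp: indep_vars_def)
  have "distr M ?C ?r = PiM {1..n} (\<lambda>j. distr M (count_space UNIV) (V j))"
    using assms rv by (subst indep_vars_iff_distr_eq_PiM'[symmetric]) auto
  also have "\<dots> = PiM {1..n} (\<lambda>_. measure_pmf P)"
    using law by (intro PiM_cong) auto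
  finally have "distr (PiM {1..n} (\<lambda>_. measure_pmf P)) (count_space UNIV) (delay n)
      = distr (distr M ?C ?r) (count_space UNIV) (delay n)" by simp
  also have "\<dots> = distr M (count_space UNIV) (delay n \<circ> ?r)"
    by (intro distr_distr measurable_PiM_finite_discrete measurable_restrict rv) auto
  also have "delay n \<circ> ?r = (\<lambda>\<omega>. delay n (\<lambda>j. V j \<omega>))"
    unfolding comp_def by (intro ext delay_cong) simp
  finally show ?thesis by simp
qed

text \<open>The unit vectors may arrive, in order and without erasure, in the first \<open>k\<close> channel uses.\<close>

lemma (in prob_space) prob_delay_le_pos:
  fixes V :: "nat \<Rightarrow> 'a \<Rightarrow> (('b::{field,finite})^('k::finite)) \<times> bool"
  assumes indep: "indep_vars (\<lambda>_. count_space UNIV) V {1..n}" and n: "CARD('k) \<le> n"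
    and eps: "0 \<le> eps" "eps < 1"
    and law: "\<And>j. j \<in> {1..n} \<Longrightarrow> distr M (count_space UNIV) (V j)
      = measure_pmf (pair_pmf (pmf_of_set (UNIV - {0})) (bernoulli_pmf eps))"
  shows "0 < prob {\<omega> \<in> space M. delay n (\<lambda>j. V j \<omega>) \<le> n}"
proof -
  let ?P = "pair_pmf (pmf_of_set (UNIV - {0 :: 'b^'k})) (bernoulli_pmf eps)"
  let ?J = "{1..CARD('k)}"
  obtain e :: "nat \<Rightarrow> 'k" where e: "bij_betw e ?J UNIV"
    using finite_same_card_bij[of ?J "UNIV :: 'k set"] by auto
  define v :: "nat \<Rightarrow> ('b^'k) \<times> bool" where "v = (\<lambda>j. (axis (e j) 1, False))"
  have rv: "V j \<in> measurable M (count_space UNIV)" if "j \<in> {1..n}" for j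
    using indep that by (auto simp: indep_vars_def)
  have pos: "0 < prob (V j -` {v j} \<inter> space M)" if "j \<in> {1..n}" for j
  proof -
    have "prob (V j -` {v j} \<inter> space M) = measure (distr M (count_space UNIV) (V j)) {v j}"
      using rv[OF that] by (subst measure_distr) auto
    also have "\<dots> = pmf ?P (v j)" by (simp only: law[OF that] measure_pmf_single)
    also have "\<dots> > 0"
    proof -
      have ne: "axis (e j) 1 \<in> UNIV - {0 :: 'b^'k}" by (simp add: axis_eq_0_iff)
      then have "set_pmf (pmf_of_set (UNIV - {0 :: 'b^'k})) = UNIV - {0}"
        by (intro set_pmf_of_set) (blast, simp)
      with ne have "pmf (pmf_of_set (UNIV - {0 :: 'b^'k})) (axis (e j) 1) > 0"
        by (intro pmf_positive) simp
      then show ?thesis using eps by (simp add: v_def pmf_pair)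
    qed
    finally show ?thesis .
  qed
  have J: "?J \<subseteq> {1..n}" using n by auto
  have "0 < (\<Prod>j\<in>?J. prob (V j -` {v j} \<inter> space M))"
    using pos J by (intro prod_pos) blast
  also have "\<dots> = prob (\<Inter>j\<in>?J. V j -` {v j} \<inter> space M)"
    using J by (intro indep_varsD[OF indep, symmetric]) auto
  also have "\<dots> \<le> prob {\<omega> \<in> space M. delay n (\<lambda>j. V j \<omega>) \<le> n}"
  proof (rule finite_measure_mono)
    show "(\<Inter>j\<in>?J. V j -` {v j} \<inter> space M) \<subseteq> {\<omega> \<in> space M. delay n (\<lambda>j. V j \<omega>) \<le> n}"
    proof
      fix \<omega> assume \<omega>: "\<omega> \<in> (\<Inter>j\<in>?J. V j -` {v j} \<inter> space M)"
      then have V: "V j \<omega> = v j" if "j \<in> ?J" for j using that by auto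
      have "cart_basis = (\<lambda>j. axis (e j) (1::'b)) ` ?J"
        using e by (auto simp: cart_basis_def bij_betw_def image_image[symmetric, of "\<lambda>i. axis i 1" e])
      also have "\<dots> \<subseteq> {fst (V j \<omega>) |j. j \<in> ?J \<and> \<not> snd (V j \<omega>)}"
        using V by (force simp: v_def)
      finally have "vec.span cart_basis \<subseteq> vec.span {fst (V j \<omega>) |j. j \<in> ?J \<and> \<not> snd (V j \<omega>)}"
        by (rule vec.span_mono)
      then have "spans_by (CARD('k)) (\<lambda>j. V j \<omega>)" by (auto simp: spans_by_def)
      then have "spans_by n (\<lambda>j. V j \<omega>)" using n by (rule spans_by_mono)
      moreover have "\<omega> \<in> space M" using \<omega> by auto
      ultimately show "\<omega> \<in> {\<omega> \<in> space M. delay n (\<lambda>j. V j \<omega>) \<le> n}" by (simp add: delay_le_iff)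
    qed
    have "(\<lambda>\<omega>. delay n (\<lambda>j. V j \<omega>)) \<in> measurable M (count_space UNIV)"
      by (intro measurable_delay rv)
    then show "{\<omega> \<in> space M. delay n (\<lambda>j. V j \<omega>) \<le> n} \<in> events"
      by measurable
  qed
  finally show ?thesis .
qed

section \<open>Integer variables with finitely many values\<close>

lemma (in prob_space) prob_eq_sum_singletons:
  fixes Y :: "'a \<Rightarrow> nat"
  assumes Y: "Y \<in> measurable M (count_space UNIV)" and "finite A"
  shows "prob {\<omega> \<in> space M. Y \<omega> \<in> A} = (\<Sum>i\<in>A. prob {\<omega> \<in> space M. Y \<omega> = i})"
proof -
  interpret Y: prob_space "distr M (count_space UNIV) Y" using Y by (rule prob_space_distr)
  have eq: "measure (distr M (count_space UNIV) Y) B = prob {\<omega> \<in> space M. Y \<omega> \<in> B}" for B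
    using Y by (subst measure_distr) (auto intro: arg_cong[where f = prob])
  show ?thesis
    using Y.finite_measure_eq_sum_singleton[OF \<open>finite A\<close>] by (simp add: eq)
qed

text \<open>Membership in \<open>A\<close> is asked for only almost surely because the law of
  \<open>T\<close> determines its range only up to a null set.\<close>

lemma (in prob_space) expectation_eq_sum_singletons:
  fixes Y :: "'a \<Rightarrow> nat" and u :: "nat \<Rightarrow> real"
  assumes Y: "Y \<in> measurable M (count_space UNIV)" and A: "finite A" "AE \<omega> in M. Y \<omega> \<in> A"
  shows "expectation (\<lambda>\<omega>. u (Y \<omega>)) = (\<Sum>i\<in>A. u i * prob {\<omega> \<in> space M. Y \<omega> = i})"
proof -
  have ev: "{\<omega> \<in> space M. Y \<omega> = i} \<in> events" for i using Y by measurable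
  have "expectation (\<lambda>\<omega>. u (Y \<omega>))
      = expectation (\<lambda>\<omega>. \<Sum>i\<in>A. u i * indicator {\<omega> \<in> space M. Y \<omega> = i} \<omega>)"
  proof (rule integral_cong_AE)
    show "AE \<omega> in M. u (Y \<omega>) = (\<Sum>i\<in>A. u i * indicator {\<omega> \<in> space M. Y \<omega> = i} \<omega>)"
      using A(2) AE_space
    proof eventually_elim
      case (elim \<omega>)
      have "(\<Sum>i\<in>A. u i * indicator {\<omega> \<in> space M. Y \<omega> = i} \<omega>) = (\<Sum>i\<in>A. if Y \<omega> = i then u i else 0)"
        using elim(2) by (intro sum.cong) auto
      then show ?case using elim(1) A(1) by simp
    qed
    show "(\<lambda>\<omega>. u (Y \<omega>)) \<in> borel_measurable M"
      using Y by (rule measurable_compose) simp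
    show "(\<lambda>\<omega>. \<Sum>i\<in>A. u i * indicator {\<omega> \<in> space M. Y \<omega> = i} \<omega>) \<in> borel_measurable M"
      using ev by (intro borel_measurable_sum borel_measurable_times borel_measurable_indicator) auto
  qed
  also have "\<dots> = (\<Sum>i\<in>A. u i * prob {\<omega> \<in> space M. Y \<omega> = i})"
    using ev by (subst Bochner_Integration.integral_sum) (auto simp: emeasure_eq_measure)
  finally show ?thesis .
qed

section \<open>The average age\<close>

theorem theorem4:
  fixes eps t0 a0 :: real and n :: nat
    and M :: "'w measure"
    and G :: "nat \<Rightarrow> nat \<Rightarrow> 'w \<Rightarrow> ('a::{field,finite})^('k::finite)"
    and X :: "nat \<Rightarrow> 'w \<Rightarrow> bool"
    and N :: "'v measure"
    and g :: "nat \<Rightarrow> 'v \<Rightarrow> 'a^'k"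
    and x :: "nat \<Rightarrow> 'v \<Rightarrow> bool"
    and B :: "'v \<Rightarrow> enat"
    and K :: "'u measure"
    and T :: "'u \<Rightarrow> nat"
    and eps_p :: real
  assumes "0 \<le> eps" and "eps < 1"
    and "CARD('k) \<ge> 2" and "n \<ge> CARD('k)"
    and scheme: "random_scheme M eps n G X"
    and columns: "iid_columns_with_erasures N eps {1..} g x"
    and B_def: "\<And>\<omega>. B \<omega> = spanning_time (\<lambda>i. g i \<omega>) (\<lambda>i. x i \<omega>)"
    and eps_p_def: "eps_p = \<P>(\<omega> in N. B \<omega> > enat n)"
    and "prob_space K"
    and "T \<in> measurable K (count_space UNIV)"
    and T_law: "\<And>i. \<P>(\<omega> in K. T \<omega> = i) =
                   \<P>(\<omega> in N. B \<omega> = enat i \<bar> B \<omega> \<le> enat n)"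
  shows "AE \<omega> in M.
           has_average (age n t0 a0 (\<lambda>l j. G l j \<omega>) (\<lambda>i. X i \<omega>))
             (prob_space.expectation K (\<lambda>\<upsilon>. real (T \<upsilon>)) - 1
               + real n * (1 + eps_p) / (2 * (1 - eps_p)) + frac (- t0))"
proof -
  have n: "1 \<le> n" using assms(3,4) by linarith
  define P where "P = pair_pmf (pmf_of_set (UNIV - {0 :: 'a^'k})) (bernoulli_pmf eps)"
  define V where "V = (\<lambda>(l, j) \<omega>. (G l j \<omega>, X (channel_use n l j) \<omega>))"
  define D where "D = (\<lambda>l \<omega>. delay n (\<lambda>j. V (l, j) \<omega>))"
  define W where "W = (\<lambda>j \<omega>. (g j \<omega>, x j \<omega>))"
  define R where "R = (\<lambda>\<omega>. delay n (\<lambda>j. W j \<omega>))"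
  define law where "law = distr (PiM {1..n} (\<lambda>_. measure_pmf P)) (count_space UNIV) (delay n)"
  have V_eq: "(\<lambda>i \<omega>. ((case i of (l, j) \<Rightarrow> G l j) \<omega>, (case i of (l, j) \<Rightarrow> X (channel_use n l j)) \<omega>)) = V"
    by (auto simp: V_def)
  have M: "prob_space M" "prob_space.indep_vars M (\<lambda>_. count_space UNIV) V ({1..} \<times> {1..n})"
    "\<And>i. i \<in> {1..} \<times> {1..n} \<Longrightarrow> distr M (count_space UNIV) (V i) = measure_pmf P"
    using scheme unfolding random_scheme_def iid_columns_with_erasures_def V_eq
    by (auto simp: V_def P_def)
  have N: "prob_space N" "prob_space.indep_vars N (\<lambda>_. count_space UNIV) W {1..}"
    "\<And>i. i \<in> {1..} \<Longrightarrow> distr N (count_space UNIV) (W i) = measure_pmf P"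
    using columns unfolding iid_columns_with_erasures_def by (auto simp: W_def P_def)
  interpret M: prob_space M by fact
  interpret N: prob_space N by fact
  interpret K: prob_space K by fact
  have Vl: "M.indep_vars (\<lambda>_. count_space UNIV) (\<lambda>j. V (l, j)) {1..n}" if "1 \<le> l" for l
    using that by (intro M.indep_vars_reindex[OF M(2)]) (auto simp: inj_on_def)
  have D_law: "distr M (count_space UNIV) (D l) = law" if "1 \<le> l" for l
    unfolding D_def law_def using that n M(3) by (intro M.distr_delay Vl) auto
  have "N.indep_vars (\<lambda>_. count_space UNIV) W {1..n}"
    by (rule N.indep_vars_subset[OF N(2)]) auto
  then have R_law: "distr N (count_space UNIV) R = law"
    unfolding R_def law_def using n N(3) by (intro N.distr_delay) auto
  have D_indep: "M.indep_vars (\<lambda>_. count_space UNIV) D {1..}"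
  proof -
    have "M.indep_vars (\<lambda>l. PiM ({l} \<times> {1..n}) (\<lambda>_. count_space UNIV))
        (\<lambda>l \<omega>. \<lambda>i\<in>{l} \<times> {1..n}. V i \<omega>) {1..}"
      by (rule M.indep_vars_restrict[OF M(2)]) (auto simp: disjoint_family_on_def)
    then have "M.indep_vars (\<lambda>_. count_space UNIV)
        (\<lambda>l \<omega>. delay n (\<lambda>j. (\<lambda>i\<in>{l} \<times> {1..n}. V i \<omega>) (l, j))) {1..}"
      by (rule M.indep_vars_compose2[where Y = "\<lambda>l v. delay n (\<lambda>j. v (l, j))"])
        (rule measurable_PiM_finite_discrete, simp)
    moreover have "(\<lambda>l \<omega>. delay n (\<lambda>j. (\<lambda>i\<in>{l} \<times> {1..n}. V i \<omega>) (l, j))) = D"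
      unfolding D_def by (intro ext delay_cong) auto
    ultimately show ?thesis by simp
  qed
  have D_range: "1 \<le> D l \<omega>" "D l \<omega> \<le> Suc n" for l \<omega>
    unfolding D_def by (rule delay_ge_1, rule delay_le)
  have pos: "0 < M.prob {\<omega> \<in> space M. D 1 \<omega> \<le> n}"
    unfolding D_def using assms(1,2,4) M(3)
    by (intro M.prob_delay_le_pos[OF Vl]) (auto simp: P_def)
  interpret D: iid_delays M n D
    using D_indep D_law D_range pos by unfold_locales auto
  \<comment> \<open>The common law of a block delay and of \<open>R\<close>, which is
    \<open>B\<close> cut off at \<open>Suc n\<close>. Probabilities on \<open>M\<close>,
    \<open>N\<close> and \<open>K\<close> are all expressed through it.\<close>
  define q where "q = (\<lambda>A. measure law A)"
  have D_q: "M.prob {\<omega> \<in> space M. D 1 \<omega> \<in> A} = q A" for A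
    using D.D_measurable[of 1] unfolding q_def D_law[of 1, OF order_refl, symmetric]
    by (subst measure_distr) (auto intro: arg_cong[where f = M.prob])
  have R_meas: "R \<in> measurable N (count_space UNIV)"
    unfolding R_def using N(2)
    by (intro measurable_delay) (auto simp: N.indep_vars_def)
  have R_q: "N.prob {\<omega> \<in> space N. R \<omega> \<in> A} = q A" for A
    using R_meas unfolding q_def R_law[symmetric]
    by (subst measure_distr) (auto intro: arg_cong[where f = N.prob])
  have R_range: "1 \<le> R \<omega>" "R \<omega> \<le> Suc n" for \<omega>
    unfolding R_def by (rule delay_ge_1, rule delay_le)
  have B_le: "B \<omega> \<le> enat n \<longleftrightarrow> R \<omega> \<in> {..n}" for \<omega>
    by (simp add: B_def spanning_time_le_iff R_def W_def delay_le_iff)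
  have B_eq: "B \<omega> = enat i \<and> B \<omega> \<le> enat n \<longleftrightarrow> R \<omega> \<in> {i} \<inter> {1..n}" for \<omega> i
  proof (cases "1 \<le> i \<and> i \<le> n")
    case True
    then show ?thesis
      using spanning_time_eq_iff[of i n "\<lambda>i. g i \<omega>" "\<lambda>i. x i \<omega>"] by (auto simp: B_def R_def W_def)
  next
    case False
    \<comment> \<open>For \<open>i = 0\<close> the left side fails since the empty set does not
      span; for \<open>i > n\<close> it contradicts \<open>B \<omega> \<le> enat n\<close>.\<close>
    have "B \<omega> \<noteq> 0"
      using spanning_time_le_iff[of "\<lambda>i. g i \<omega>" "\<lambda>i. x i \<omega>" 0] not_spans_by_0
      by (auto simp: B_def zero_enat_def)
    then show ?thesis using False by (auto simp: zero_enat_def not_le)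
  qed
  define p where "p = q {..n}"
  have p: "p = D.p" unfolding p_def D.p_def D_q[symmetric] by simp
  have p_pos: "0 < p" using D.p_pos p by simp
  have p_sum: "p = (\<Sum>i=1..n. q {i})"
  proof -
    have "p = M.prob {\<omega> \<in> space M. D 1 \<omega> \<in> {1..n}}"
      unfolding p_def D_q[symmetric] using D_range(1)[of 1] by (auto intro: arg_cong[where f = M.prob])
    also have "\<dots> = (\<Sum>i=1..n. M.prob {\<omega> \<in> space M. D 1 \<omega> = i})"
      using D.D_measurable[of 1] by (intro M.prob_eq_sum_singletons) auto
    finally show ?thesis using D_q[of "{_}"] by simp
  qed
  have eps_p: "eps_p = q {Suc n}"
    unfolding eps_p_def R_q[symmetric]
    using B_le R_range(2) by (intro arg_cong[where f = N.prob]) (auto simp: not_le[symmetric] le_Suc_eq)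
  have q_total: "p + eps_p = 1"
  proof -
    have "1 = M.prob {\<omega> \<in> space M. D 1 \<omega> \<in> {1..Suc n}}"
      using D_range[of 1] M.prob_space by simp
    also have "\<dots> = (\<Sum>i=1..Suc n. M.prob {\<omega> \<in> space M. D 1 \<omega> = i})"
      using D.D_measurable[of 1] by (intro M.prob_eq_sum_singletons) auto
    finally show ?thesis using D_q[of "{_}"] p_sum eps_p by simp
  qed
  have E_min: "D.E (\<lambda>d. real (min d n)) = (\<Sum>i=1..n. real i * q {i}) + real n * eps_p"
  proof -
    have "D.E (\<lambda>d. real (min d n))
        = (\<Sum>i=1..Suc n. real (min i n) * M.prob {\<omega> \<in> space M. D 1 \<omega> = i})"
      unfolding D.E_def using D.D_measurable[of 1] D_range[of 1]
      by (intro M.expectation_eq_sum_singletons) auto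
    also have "\<dots> = (\<Sum>i=1..n. real (min i n) * q {i}) + real n * eps_p"
      using D_q[of "{_}"] eps_p by simp
    also have "(\<Sum>i=1..n. real (min i n) * q {i}) = (\<Sum>i=1..n. real i * q {i})"
      by (intro sum.cong) auto
    finally show ?thesis .
  qed
  have T_q: "K.prob {\<upsilon> \<in> space K. T \<upsilon> = i} = q {i} / p" if "i \<in> {1..n}" for i
  proof -
    have "{i} \<inter> {1..n} = {i}" using that by auto
    moreover have "K.prob {\<upsilon> \<in> space K. T \<upsilon> = i} = q ({i} \<inter> {1..n}) / q {..n}"
      unfolding T_law cond_prob_def B_eq unfolding B_le R_q ..
    ultimately show ?thesis by (simp add: p_def)
  qed
  have E_T: "K.expectation (\<lambda>\<upsilon>. real (T \<upsilon>)) = (\<Sum>i=1..n. real i * q {i}) / p"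
  proof -
    \<comment> \<open>The point masses on \<open>{1..n}\<close> already add up to 1, so
      \<open>T\<close> almost surely has no other value.\<close>
    have "K.prob {\<upsilon> \<in> space K. T \<upsilon> \<in> {1..n}} = (\<Sum>i=1..n. q {i} / p)"
      using T_q by (subst K.prob_eq_sum_singletons[OF assms(10)]) auto
    also have "\<dots> = 1" using p_sum p_pos by (simp add: sum_divide_distrib[symmetric])
    finally have "AE \<upsilon> in K. \<upsilon> \<in> {\<upsilon> \<in> space K. T \<upsilon> \<in> {1..n}}"
      by (rule K.AE_prob_1)
    then have "K.expectation (\<lambda>\<upsilon>. real (T \<upsilon>)) = (\<Sum>i=1..n. real i * K.prob {\<upsilon> \<in> space K. T \<upsilon> = i})"
      by (intro K.expectation_eq_sum_singletons[OF assms(10)]) auto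
    then show ?thesis using T_q by (simp add: sum_divide_distrib)
  qed
  have p_eq: "1 - eps_p = p" "1 + eps_p = 2 - p" "eps_p = 1 - p" using q_total by simp_all
  \<comment> \<open>Here \<open>s\<close> is the sum of \<open>real i * q {i}\<close>, so
    \<open>s / p\<close> is the mean of \<open>T\<close>; the share \<open>n * (1 - p)\<close> of
    the lost blocks merges with \<open>n / 2\<close>.\<close>
  have "real n / 2 + (s + real n * (1 - p)) / p = s / p + real n * (2 - p) / (2 * p)" for s
    using p_pos by (simp add: field_simps)
  then have average_eq: "real n / 2 + D.E (\<lambda>d. real (min d n)) / D.p + frac (- t0) - 1
      = K.expectation (\<lambda>\<upsilon>. real (T \<upsilon>)) - 1 + real n * (1 + eps_p) / (2 * (1 - eps_p)) + frac (- t0)"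
    unfolding E_min E_T p[symmetric] p_eq(1,2) unfolding p_eq(3) by simp
  show ?thesis
    using D.AE_gap_average[of "\<lambda>d. real (min d n)"]
  proof eventually_elim
    case (elim \<omega>)
    let ?Z = "\<lambda>l. D l \<omega> \<le> n"
    interpret block_delays n "\<lambda>l. D l \<omega>"
      using n D_range by unfold_locales
    \<comment> \<open>A ratio below 1 keeps the gap of block \<open>Suc (m\<^sup>2)\<close> from
      reaching back to block 0, so it ends at a block that is really decoded.\<close>
    have "\<forall>\<^sub>F m in sequentially. real (gap ?Z (Suc (m\<^sup>2))) / real (m\<^sup>2) < 1"
      using elim by (intro order_tendstoD(2)) auto
    then have "\<forall>\<^sub>F m in sequentially. 0 < m \<and> real (gap ?Z (Suc (m\<^sup>2))) / real (m\<^sup>2) < 1"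
      using eventually_gt_at_top[of 0] by eventually_elim simp
    then obtain m :: nat where m: "0 < m" "real (gap ?Z (Suc (m\<^sup>2))) / real (m\<^sup>2) < 1"
      by (auto simp: eventually_sequentially)
    then have "real (gap ?Z (Suc (m\<^sup>2))) < real (m\<^sup>2)" by (simp add: field_simps)
    then have "gap ?Z (Suc (m\<^sup>2)) < m\<^sup>2" by (simp only: of_nat_less_iff)
    then have ex: "1 \<le> Suc (m\<^sup>2) - gap ?Z (Suc (m\<^sup>2))" "?Z (Suc (m\<^sup>2) - gap ?Z (Suc (m\<^sup>2)))"
      using gap_spec(1)[of "Suc (m\<^sup>2)" ?Z] by linarith+
    show ?case
      unfolding average_eq[symmetric] using elim ex
      by (intro has_average_age) (auto simp: D_def V_def)
  qed
qed

end
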